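(* Let $\mathfrak{N}\subset\mathfrak{M}$. There exists a Banach space $X_{\mathfrak{N}}$ with $\mathfrak{M}\big((X_{\mathfrak{N}})^{f}\big)=\mathfrak{N}$ if and only if $\mathfrak{N}$ satisfies the following three conditions: (H) if $A\in\mathfrak{N}$ and $B\in H(A)$, then $B\in\mathfrak{N}$; (A$_0$) if $A,B\in\mathfrak{N}$, then there exists $C\in\mathfrak{N}$ such that $A\in H(C)$ and $B\in H(C)$; (C) $\mathfrak{N}$ is closed in $\mathfrak{M}$.
   Context: All Banach spaces are over $\mathbb{R}$. The Banach–Mazur distance is $d(X,Y)=\inf\{\|u\|\|u^{-1}\|: u:X\to Y \text{ an isomorphism}\}$ ($\inf\varnothing=\infty$). $\mathfrak{M}_n$ is the set of all $n$-dimensional Banach spaces (isometric spaces identified) with the metric $\log d$; it is a compact metric space. $\mathfrak{M}=\bigcup_{n<\infty}\mathfrak{M}_n$ is the disjoint union of these spaces (the Minkowski space), a separable metric space. For a Banach space $X$, $H(X)\subset\mathfrak{M}$ is the set of all finite-dimensional subspaces of $X$, isometric ones being identified. $X$ is finitely representable in $Y$ if for every $\varepsilon>0$ and every finite-dimensional subspace $A$ of $X$ there are a subspace $B$ of $Y$ and an isomorphism $u:A\to B$ with $\|u\|\|u^{-1}\|<1+\varepsilon$. $X\sim_f Y$ means each is finitely representable in the other, and $X^f$ is the class of all Banach spaces $Y$ with $Y\sim_f X$. $\mathfrak{M}(X^f)$ denotes the closure $\overline{H(X)}$ of $H(X)$ in $\mathfrak{M}$; it depends only on the class $X^f$. *)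

theory Defs
  imports "HOL-Analysis.Analysis" "HOL-Analysis.Finite_Function_Topology"
begin

text \<open>
  Since one has to quantify over Banach spaces inside formulas, a space is a value and not a type:
  a linear subspace \<open>vecs X\<close> of some ambient real vector space together with a norm of its own.
  The values of \<open>nrm X\<close> outside \<open>vecs X\<close> are irrelevant. A type of class \<^class>\<open>banach\<close> is the
  special case \<open>\<lparr>vecs = UNIV, nrm = norm\<rparr>\<close>.
\<close>

record 'v nspace =
  vecs :: "'v set"
  nrm :: "'v \<Rightarrow> real"

definition normed_space :: "('v::real_vector) nspace \<Rightarrow> bool" where
  "normed_space X \<longleftrightarrow>
     subspace (vecs X) \<and>
     (\<forall>x\<in>vecs X. 0 \<le> nrm X x) \<and>
     (\<forall>x\<in>vecs X. nrm X x = 0 \<longleftrightarrow> x = 0) \<and>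
     (\<forall>x\<in>vecs X. \<forall>c. nrm X (c *\<^sub>R x) = \<bar>c\<bar> * nrm X x) \<and>
     (\<forall>x\<in>vecs X. \<forall>y\<in>vecs X. nrm X (x + y) \<le> nrm X x + nrm X y)"

definition banach_space :: "('v::real_vector) nspace \<Rightarrow> bool" where
  "banach_space X \<longleftrightarrow>
     normed_space X \<and>
     (\<forall>s. (\<forall>n::nat. s n \<in> vecs X) \<and>
          (\<forall>e>0. \<exists>M. \<forall>m\<ge>M. \<forall>n\<ge>M. nrm X (s m - s n) < e)
        \<longrightarrow> (\<exists>l\<in>vecs X. (\<lambda>n. nrm X (s n - l)) \<longlonglongrightarrow> 0))"

definition fin_dim :: "('v::real_vector) set \<Rightarrow> bool" where
  "fin_dim V \<longleftrightarrow> (\<exists>S. finite S \<and> V = span S)"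

definition fd_subspace :: "'v set \<Rightarrow> ('v::real_vector) nspace \<Rightarrow> bool" where
  "fd_subspace B X \<longleftrightarrow> B \<subseteq> vecs X \<and> fin_dim B"

abbreviation restr :: "'v nspace \<Rightarrow> 'v set \<Rightarrow> 'v nspace" where
  "restr X B \<equiv> X\<lparr>vecs := B\<rparr>"


definition linear_on :: "('v::real_vector) set \<Rightarrow> ('v \<Rightarrow> 'w::real_vector) \<Rightarrow> bool" where
  "linear_on V u \<longleftrightarrow>
     (\<forall>x\<in>V. \<forall>y\<in>V. u (x + y) = u x + u y) \<and> (\<forall>x\<in>V. \<forall>c. u (c *\<^sub>R x) = c *\<^sub>R u x)"

definition bounded_op :: "('v::real_vector) nspace \<Rightarrow> ('w::real_vector) nspace \<Rightarrow> ('v \<Rightarrow> 'w) \<Rightarrow> bool" where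
  "bounded_op X Y u \<longleftrightarrow>
     linear_on (vecs X) u \<and> u ` vecs X \<subseteq> vecs Y \<and>
     (\<exists>K. \<forall>x\<in>vecs X. nrm Y (u x) \<le> K * nrm X x)"

definition opnorm :: "('v::real_vector) nspace \<Rightarrow> ('w::real_vector) nspace \<Rightarrow> ('v \<Rightarrow> 'w) \<Rightarrow> real" where
  "opnorm X Y u = Sup {nrm Y (u x) | x. x \<in> vecs X \<and> nrm X x \<le> 1}"

abbreviation op_inv :: "'v nspace \<Rightarrow> ('v \<Rightarrow> 'w) \<Rightarrow> 'w \<Rightarrow> 'v" where
  "op_inv X u \<equiv> inv_into (vecs X) u"

definition isomorphism :: "('v::real_vector) nspace \<Rightarrow> ('w::real_vector) nspace \<Rightarrow> ('v \<Rightarrow> 'w) \<Rightarrow> bool" where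
  "isomorphism X Y u \<longleftrightarrow>
     bij_betw u (vecs X) (vecs Y) \<and> bounded_op X Y u \<and> bounded_op Y X (op_inv X u)"

definition bm_dist :: "('v::real_vector) nspace \<Rightarrow> ('w::real_vector) nspace \<Rightarrow> ereal" where
  "bm_dist X Y = Inf {ereal (opnorm X Y u * opnorm Y X (op_inv X u)) | u. isomorphism X Y u}"

definition isometric :: "('v::real_vector) nspace \<Rightarrow> ('w::real_vector) nspace \<Rightarrow> bool" where
  "isometric X Y \<longleftrightarrow>
     (\<exists>u. bij_betw u (vecs X) (vecs Y) \<and> linear_on (vecs X) u \<and>
          (\<forall>x\<in>vecs X. nrm Y (u x) = nrm X x))"


lemma normed_spaceD:
  assumes "normed_space X"
  shows "subspace (vecs X)"
    and "\<And>x. x \<in> vecs X \<Longrightarrow> 0 \<le> nrm X x"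
    and "\<And>x. x \<in> vecs X \<Longrightarrow> nrm X x = 0 \<longleftrightarrow> x = 0"
    and "\<And>x c. x \<in> vecs X \<Longrightarrow> nrm X (c *\<^sub>R x) = \<bar>c\<bar> * nrm X x"
    and "\<And>x y. x \<in> vecs X \<Longrightarrow> y \<in> vecs X \<Longrightarrow> nrm X (x + y) \<le> nrm X x + nrm X y"
  using assms unfolding normed_space_def by auto

lemma nrm_minus:
  assumes "normed_space X" "x \<in> vecs X"
  shows "nrm X (- x) = nrm X x"
  using normed_spaceD(4)[OF assms, of "-1"] by simp

lemma nrm_commute:
  assumes "normed_space X" "x \<in> vecs X" "y \<in> vecs X"
  shows "nrm X (x - y) = nrm X (y - x)"
  using nrm_minus[OF assms(1), of "x - y"] normed_spaceD(1)[OF assms(1)] assms(2,3)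
  by (simp add: subspace_diff)

lemma nrm_triangle3:
  assumes "normed_space X" "x \<in> vecs X" "y \<in> vecs X" "z \<in> vecs X"
  shows "nrm X (x - z) \<le> nrm X (x - y) + nrm X (y - z)"
  using normed_spaceD(5)[OF assms(1), of "x - y" "y - z"] normed_spaceD(1)[OF assms(1)] assms(2-)
  by (simp add: subspace_diff)

lemma normed_space_restr:
  assumes "normed_space X" "subspace B" "B \<subseteq> vecs X"
  shows "normed_space (restr X B)"
  using assms unfolding normed_space_def by (simp add: subset_iff)

lemma banach_space_span:
  fixes X :: "('v::real_vector) nspace"
  assumes "finite S" "vecs X = span S" "normed_space X"
  shows "banach_space X"
  using assms
proof (induction S arbitrary: X rule: finite_induct)
  case empty
  then have "\<exists>l\<in>vecs X. (\<lambda>n. nrm X (s n - l)) \<longlonglongrightarrow> 0" if "\<forall>n. s n \<in> vecs X" for s :: "nat \<Rightarrow> 'v"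
    using that normed_spaceD(3)[OF empty(2), of 0] by auto
  with empty show ?case unfolding banach_space_def by blast
next
  case (insert a S)
  note X = insert.prems(2)
  note sub = normed_spaceD(1)[OF X]
  show ?case
  proof (cases "a \<in> span S")
    case True
    then have "vecs X = span S" using insert.prems(1) by (simp add: span_redundant)
    with insert show ?thesis by blast
  next
    case a: False
    let ?N = "nrm X"
    have WX: "span S \<subseteq> vecs X" using insert.prems(1) by (simp add: span_mono subset_insertI)
    have aX: "a \<in> vecs X" using insert.prems(1) by (simp add: span_base)
    have "normed_space (restr X (span S))" using normed_space_restr[OF X _ WX] by simp
    then have "banach_space (restr X (span S))" using insert.IH[of "restr X (span S)"] by simp
    then have W: "\<exists>l\<in>span S. (\<lambda>n. ?N (s n - l)) \<longlonglongrightarrow> 0"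
      if "\<And>n. s n \<in> span S" "\<And>e. e > 0 \<Longrightarrow> \<exists>M. \<forall>m\<ge>M. \<forall>n\<ge>M. ?N (s m - s n) < e"
      for s :: "nat \<Rightarrow> 'v"
      using that unfolding banach_space_def by simp
    have "\<exists>d>0. \<forall>w\<in>span S. d \<le> ?N (a - w)"
    proof (rule ccontr)
      assume "\<not> ?thesis"
      then have "\<forall>n::nat. \<exists>w\<in>span S. ?N (a - w) < inverse (real (Suc n))"
        by (metis inverse_positive_iff_positive of_nat_0_less_iff zero_less_Suc not_less)
      then obtain w where w: "\<And>n. w n \<in> span S" "\<And>n. ?N (a - w n) < inverse (real (Suc n))"
        by metis
      have wX: "w n \<in> vecs X" for n using w WX by blast
      have "\<exists>l\<in>span S. (\<lambda>n. ?N (w n - l)) \<longlonglongrightarrow> 0"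
      proof (rule W)
        fix e :: real assume "e > 0"
        then obtain M where M: "inverse (real (Suc M)) < e/2"
          using reals_Archimedean[of "e/2"] by auto
        have b: "?N (a - w n) < e/2" if "n \<ge> M" for n
        proof -
          have "inverse (real (Suc n)) \<le> inverse (real (Suc M))" using that by (simp add: field_simps)
          with w(2)[of n] M show ?thesis by linarith
        qed
        have "?N (w m - w n) < e" if "m \<ge> M" "n \<ge> M" for m n
        proof -
          have "?N (w m - w n) \<le> ?N (w m - a) + ?N (a - w n)"
            by (rule nrm_triangle3[OF X wX aX wX])
          then show ?thesis using b[OF that(1)] b[OF that(2)] nrm_commute[OF X wX[of m] aX] by linarith
        qed
        then show "\<exists>M. \<forall>m\<ge>M. \<forall>n\<ge>M. ?N (w m - w n) < e" by blast
      qed (use w in auto)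
      then obtain l where l: "l \<in> span S" "(\<lambda>n. ?N (w n - l)) \<longlonglongrightarrow> 0" by blast
      have lX: "l \<in> vecs X" using l WX by blast
      have "(\<lambda>n. inverse (real (Suc n)) + ?N (w n - l)) \<longlonglongrightarrow> 0 + 0"
        by (intro tendsto_add l LIMSEQ_inverse_real_of_nat)
      moreover have "?N (a - l) \<le> inverse (real (Suc n)) + ?N (w n - l)" for n
        using nrm_triangle3[OF X aX wX lX, of n] w(2)[of n] by linarith
      ultimately have "?N (a - l) \<le> 0"
        by (metis (no_types, lifting) LIMSEQ_le_const add.right_neutral)
      moreover have "a - l \<in> vecs X" using sub aX lX by (simp add: subspace_diff)
      ultimately have "a = l" using normed_spaceD(2,3)[OF X, of "a - l"] by auto
      then show False using a l by simp
    qed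
    then obtain d where d: "d > 0" "\<And>w. w \<in> span S \<Longrightarrow> d \<le> ?N (a - w)" by blast
    have bd: "\<bar>k\<bar> * d \<le> ?N x" if x: "x \<in> vecs X" "x - k *\<^sub>R a \<in> span S" for k x
    proof (cases "k = 0")
      case True
      then show ?thesis using normed_spaceD(2)[OF X x(1)] by simp
    next
      case k: False
      let ?w = "- ((1/k) *\<^sub>R (x - k *\<^sub>R a))"
      have w: "?w \<in> span S" using x(2) by (intro span_neg span_scale)
      have "x = k *\<^sub>R (a - ?w)" using k by (simp add: algebra_simps)
      then have "?N x = \<bar>k\<bar> * ?N (a - ?w)"
        using normed_spaceD(4)[OF X, of "a - ?w" k] sub aX w WX
        by (metis subsetD subspace_diff)
      moreover have "\<bar>k\<bar> * d \<le> \<bar>k\<bar> * ?N (a - ?w)" by (intro mult_left_mono d w) simp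
      ultimately show ?thesis by simp
    qed
    have "\<exists>l\<in>vecs X. (\<lambda>n. ?N (s n - l)) \<longlonglongrightarrow> 0"
      if s: "\<And>n. s n \<in> vecs X" and C: "\<And>e. e > 0 \<Longrightarrow> \<exists>M. \<forall>m\<ge>M. \<forall>n\<ge>M. ?N (s m - s n) < e"
      for s :: "nat \<Rightarrow> 'v"
    proof -
      have "\<forall>n. \<exists>k. s n - k *\<^sub>R a \<in> span S"
        using s insert.prems(1) span_breakdown_eq by blast
      then obtain k where k: "\<And>n. s n - k n *\<^sub>R a \<in> span S" by metis
      have kk: "\<bar>k m - k n\<bar> * d \<le> ?N (s m - s n)" for m n
      proof (rule bd)
        show "s m - s n \<in> vecs X" using sub s by (simp add: subspace_diff)
        have "(s m - k m *\<^sub>R a) - (s n - k n *\<^sub>R a) \<in> span S" by (intro span_diff k)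
        then show "s m - s n - (k m - k n) *\<^sub>R a \<in> span S" by (simp add: algebra_simps)
      qed
      have Ck: "\<exists>M. \<forall>m\<ge>M. \<forall>n\<ge>M. \<bar>k m - k n\<bar> < e" if epos: "e > 0" for e
      proof -
        obtain M where M: "\<forall>m\<ge>M. \<forall>n\<ge>M. ?N (s m - s n) < e * d"
          using C[OF mult_pos_pos[OF epos d(1)]] by blast
        have "\<bar>k m - k n\<bar> < e" if "m \<ge> M" "n \<ge> M" for m n
        proof -
          have "\<bar>k m - k n\<bar> * d < e * d" using kk[of m n] M that by fastforce
          then show ?thesis using d by simp
        qed
        then show ?thesis by blast
      qed
      then have "Cauchy k" unfolding Cauchy_def dist_real_def by blast
      then obtain K where K: "k \<longlonglongrightarrow> K" using Cauchy_convergent_iff convergent_def by blast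
      define r where "r n = s n - k n *\<^sub>R a" for n
      have rX: "r n \<in> vecs X" for n using k WX unfolding r_def by blast
      have aN: "0 \<le> ?N a" by (rule normed_spaceD(2)[OF X aX])
      have "\<exists>l\<in>span S. (\<lambda>n. ?N (r n - l)) \<longlonglongrightarrow> 0"
      proof (rule W)
        show "r n \<in> span S" for n using k unfolding r_def .
        fix e :: real assume e: "e > 0"
        define e' where "e' = e / (2 * (?N a + 1))"
        have e': "e' > 0" using e aN unfolding e'_def by simp
        obtain M1 where M1: "\<forall>m\<ge>M1. \<forall>n\<ge>M1. ?N (s m - s n) < e/2" using C[of "e/2"] e by auto
        obtain M2 where M2: "\<forall>m\<ge>M2. \<forall>n\<ge>M2. \<bar>k m - k n\<bar> < e'" using Ck[OF e'] by blast
        have "?N (r m - r n) < e" if mn: "m \<ge> max M1 M2" "n \<ge> max M1 M2" for m n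
        proof -
          have eq: "r m - r n = (s m - s n) + (k n - k m) *\<^sub>R a"
            unfolding r_def by (simp add: algebra_simps)
          have "?N (r m - r n) \<le> ?N (s m - s n) + ?N ((k n - k m) *\<^sub>R a)"
            unfolding eq using sub s aX
            by (intro normed_spaceD(5)[OF X]) (auto simp: subspace_diff subspace_scale)
          also have "?N ((k n - k m) *\<^sub>R a) = \<bar>k n - k m\<bar> * ?N a" by (rule normed_spaceD(4)[OF X aX])
          also have "\<dots> \<le> e' * ?N a" using M2 mn aN by (intro mult_right_mono) (auto intro: less_imp_le)
          also have "\<dots> \<le> e/2" using aN e unfolding e'_def by (simp add: field_simps)
          finally show ?thesis using M1 mn by fastforce
        qed
        then show "\<exists>M. \<forall>m\<ge>M. \<forall>n\<ge>M. ?N (r m - r n) < e" by blast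
      qed
      then obtain l where l: "l \<in> span S" "(\<lambda>n. ?N (r n - l)) \<longlonglongrightarrow> 0" by blast
      have lX: "l \<in> vecs X" using l WX by blast
      have "(\<lambda>n. \<bar>k n - K\<bar> * ?N a + ?N (r n - l)) \<longlonglongrightarrow> \<bar>K - K\<bar> * ?N a + 0"
        by (intro tendsto_intros K l)
      then have lim: "(\<lambda>n. \<bar>k n - K\<bar> * ?N a + ?N (r n - l)) \<longlonglongrightarrow> 0" by simp
      have LX: "K *\<^sub>R a + l \<in> vecs X" using sub aX lX by (simp add: subspace_add subspace_scale)
      have le: "?N (s n - (K *\<^sub>R a + l)) \<le> \<bar>k n - K\<bar> * ?N a + ?N (r n - l)" for n
      proof -
        have eq: "s n - (K *\<^sub>R a + l) = (k n - K) *\<^sub>R a + (r n - l)"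
          unfolding r_def by (simp add: algebra_simps)
        show ?thesis
          unfolding eq normed_spaceD(4)[OF X aX, symmetric]
          using sub aX rX lX
          by (intro normed_spaceD(5)[OF X]) (auto simp: subspace_diff subspace_scale)
      qed
      have "(\<lambda>n. ?N (s n - (K *\<^sub>R a + l))) \<longlonglongrightarrow> 0"
      proof (rule tendsto_sandwich[OF _ _ tendsto_const lim])
        show "\<forall>\<^sub>F n in sequentially. 0 \<le> ?N (s n - (K *\<^sub>R a + l))"
          using normed_spaceD(2)[OF X] sub s LX by (intro always_eventually allI) (simp add: subspace_diff)
      qed (use le in auto)
      then show ?thesis using LX by blast
    qed
    then show ?thesis using X unfolding banach_space_def by blast
  qed
qed

lemma fin_dim_subspace: "fin_dim B \<Longrightarrow> subspace B"
  unfolding fin_dim_def by auto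

lemma banach_space_fin_dim: "normed_space X \<Longrightarrow> fin_dim (vecs X) \<Longrightarrow> banach_space X"
  unfolding fin_dim_def using banach_space_span by blast


lemma linear_on_inv_into:
  assumes "subspace V" "linear_on V u" "bij_betw u V W"
  shows "linear_on W (inv_into V u)"
  unfolding linear_on_def
proof (intro conjI ballI allI)
  have inj: "inj_on u V" and im: "u ` V = W" using assms(3) unfolding bij_betw_def by auto
  fix y assume y: "y \<in> W"
  then have iy: "inv_into V u y \<in> V" "u (inv_into V u y) = y"
    using im by (auto simp: inv_into_into f_inv_into_f)
  {
    fix z assume z: "z \<in> W"
    then have iz: "inv_into V u z \<in> V" "u (inv_into V u z) = z"
      using im by (auto simp: inv_into_into f_inv_into_f)
    have "u (inv_into V u y + inv_into V u z) = y + z"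
      using assms(2) iy iz unfolding linear_on_def by simp
    then show "inv_into V u (y + z) = inv_into V u y + inv_into V u z"
      using inj iy(1) iz(1) assms(1) by (metis inv_into_f_f subspace_add)
  }
  fix c
  have "u (c *\<^sub>R inv_into V u y) = c *\<^sub>R y"
    using assms(2) iy unfolding linear_on_def by simp
  then show "inv_into V u (c *\<^sub>R y) = c *\<^sub>R inv_into V u y"
    using inj iy(1) assms(1) by (metis inv_into_f_f subspace_scale)
qed

lemma linear_on_comp:
  assumes "linear_on V u" "u ` V \<subseteq> W" "linear_on W v"
  shows "linear_on V (\<lambda>x. v (u x))"
  using assms unfolding linear_on_def by (auto simp: image_subset_iff)

lemma isometric_refl: "isometric X X"
  unfolding isometric_def linear_on_def by (rule exI[of _ "\<lambda>x. x"]) (auto simp: bij_betw_def)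

lemma isometric_sym:
  assumes "subspace (vecs X)" "isometric X Y"
  shows "isometric Y X"
proof -
  obtain u where u: "bij_betw u (vecs X) (vecs Y)" "linear_on (vecs X) u"
    "\<And>x. x \<in> vecs X \<Longrightarrow> nrm Y (u x) = nrm X x"
    using assms(2) unfolding isometric_def by blast
  have "nrm X (inv_into (vecs X) u y) = nrm Y y" if "y \<in> vecs Y" for y
    using u(1) u(3)[of "inv_into (vecs X) u y"] that
    by (metis bij_betw_imp_surj_on f_inv_into_f inv_into_into)
  then show ?thesis
    unfolding isometric_def
    using bij_betw_inv_into[OF u(1)] linear_on_inv_into[OF assms(1) u(2,1)] by blast
qed

lemma isometric_trans:
  assumes "isometric X Y" "isometric Y Z"
  shows "isometric X Z"
proof -
  obtain u where u: "bij_betw u (vecs X) (vecs Y)" "linear_on (vecs X) u"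
    "\<And>x. x \<in> vecs X \<Longrightarrow> nrm Y (u x) = nrm X x"
    using assms(1) unfolding isometric_def by blast
  obtain v where v: "bij_betw v (vecs Y) (vecs Z)" "linear_on (vecs Y) v"
    "\<And>x. x \<in> vecs Y \<Longrightarrow> nrm Z (v x) = nrm Y x"
    using assms(2) unfolding isometric_def by blast
  have im: "u ` vecs X = vecs Y" using u(1) by (simp add: bij_betw_def)
  have "bij_betw (\<lambda>x. v (u x)) (vecs X) (vecs Z)"
    using bij_betw_trans[OF u(1) v(1)] by (simp add: comp_def)
  moreover have "linear_on (vecs X) (\<lambda>x. v (u x))" using linear_on_comp[OF u(2) _ v(2)] im by blast
  ultimately show ?thesis
    unfolding isometric_def using u(3) v(3) im by (metis imageI)
qed


text \<open>
  A point of \<open>minkowski\<close> is an isometry class of nonzero finite-dimensional Banach spaces, so the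
  type is the disjoint union of the sets of isometry classes of \<open>n\<close>-dimensional spaces over
  \<open>n \<ge> 1\<close>. Every finite-dimensional space has an isometric copy carried by a subspace of the
  space of finitely supported real sequences.
\<close>

definition fd_isometric :: "(nat \<Rightarrow>\<^sub>0 real) nspace \<Rightarrow> (nat \<Rightarrow>\<^sub>0 real) nspace \<Rightarrow> bool" where
  "fd_isometric A B \<longleftrightarrow>
     (banach_space A \<and> fin_dim (vecs A) \<and> vecs A \<noteq> {0}) \<and>
     (banach_space B \<and> fin_dim (vecs B) \<and> vecs B \<noteq> {0}) \<and>
     isometric A B"

definition line_nspace :: "(nat \<Rightarrow>\<^sub>0 real) nspace" where
  "line_nspace = \<lparr>vecs = span {Poly_Mapping.single 0 1}, nrm = norm\<rparr>"

lemma normed_space_norm: "subspace V \<Longrightarrow> normed_space \<lparr>vecs = V, nrm = norm\<rparr>"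
  unfolding normed_space_def by (simp add: norm_triangle_ineq)

lemma line_nspace_fd: "banach_space line_nspace" "fin_dim (vecs line_nspace)" "vecs line_nspace \<noteq> {0}"
proof -
  show f: "fin_dim (vecs line_nspace)" unfolding line_nspace_def fin_dim_def by (auto intro!: exI[of _ "{Poly_Mapping.single 0 1}"])
  show "banach_space line_nspace" by (rule banach_space_fin_dim[OF _ f]) (simp add: line_nspace_def normed_space_norm)
  have "Poly_Mapping.single (0::nat) (1::real) \<in> vecs line_nspace" unfolding line_nspace_def by (simp add: span_base)
  moreover have "Poly_Mapping.single (0::nat) (1::real) \<noteq> 0" by (metis lookup_single_eq lookup_zero zero_neq_one)
  ultimately show "vecs line_nspace \<noteq> {0}" by blast
qed

quotient_type minkowski = "(nat \<Rightarrow>\<^sub>0 real) nspace" / partial: fd_isometric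
proof (rule part_equivpI)
  show "\<exists>A. fd_isometric A A" unfolding fd_isometric_def using line_nspace_fd isometric_refl by blast
  show "symp fd_isometric"
    by (rule sympI) (auto simp: fd_isometric_def intro: isometric_sym fin_dim_subspace)
  show "transp fd_isometric"
    by (rule transpI) (auto simp: fd_isometric_def intro: isometric_trans)
qed

definition mdist :: "minkowski \<Rightarrow> minkowski \<Rightarrow> ereal" where
  "mdist A B = bm_dist (rep_minkowski A) (rep_minkowski B)"

text \<open>
  The topology of the metric \<open>log d\<close>: the condition \<open>mdist A B < exp e\<close> says \<open>log d(A,B) < e\<close>.
  Spaces of different dimension have \<open>mdist A B = \<infinity>\<close>, hence the sets of \<open>n\<close>-dimensional
  spaces are open, and the topology is that of the disjoint union.
\<close>

instantiation minkowski :: topological_space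
begin

definition open_minkowski :: "minkowski set \<Rightarrow> bool" where
  "open_minkowski U \<longleftrightarrow> (\<forall>A\<in>U. \<exists>e>0. \<forall>B. mdist A B < ereal (exp e) \<longrightarrow> B \<in> U)"

instance
proof
  show "open (UNIV :: minkowski set)" unfolding open_minkowski_def by (auto intro: exI[of _ 1])
  fix S T :: "minkowski set" assume S: "open S" and T: "open T"
  show "open (S \<inter> T)"
    unfolding open_minkowski_def
  proof
    fix A assume "A \<in> S \<inter> T"
    then obtain e f where ef: "e > 0" "f > 0" "\<forall>B. mdist A B < ereal (exp e) \<longrightarrow> B \<in> S"
      "\<forall>B. mdist A B < ereal (exp f) \<longrightarrow> B \<in> T"
      using S T unfolding open_minkowski_def by blast
    have "mdist A B < ereal (exp e) \<and> mdist A B < ereal (exp f)"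
      if "mdist A B < ereal (exp (min e f))" for B
      using that by (metis ereal_less_eq(3) exp_le_cancel_iff less_le_trans min.cobounded1 min.cobounded2)
    with ef show "\<exists>e>0. \<forall>B. mdist A B < ereal (exp e) \<longrightarrow> B \<in> S \<inter> T"
      by (intro exI[of _ "min e f"]) auto
  qed
next
  fix K :: "minkowski set set" assume "\<forall>S\<in>K. open S"
  then show "open (\<Union>K)" unfolding open_minkowski_def by (meson UnionE UnionI)
qed

end

definition subspaces_of :: "('v::real_vector) nspace \<Rightarrow> minkowski set" where
  "subspaces_of X =
     {A. \<exists>B. fd_subspace B X \<and> B \<noteq> {0} \<and> isometric (rep_minkowski A) (restr X B)}"

abbreviation msubspaces_of :: "minkowski \<Rightarrow> minkowski set" where
  "msubspaces_of A \<equiv> subspaces_of (rep_minkowski A)"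


definition finitely_representable :: "('v::real_vector) nspace \<Rightarrow> ('w::real_vector) nspace \<Rightarrow> bool" where
  "finitely_representable X Y \<longleftrightarrow>
     (\<forall>e>0. \<forall>A. fd_subspace A X \<longrightarrow>
        (\<exists>B u. fd_subspace B Y \<and> isomorphism (restr X A) (restr Y B) u \<and>
           opnorm (restr X A) (restr Y B) u * opnorm (restr Y B) (restr X A) (op_inv (restr X A) u)
             < 1 + e))"

definition fin_equiv :: "('v::real_vector) nspace \<Rightarrow> ('w::real_vector) nspace \<Rightarrow> bool" where
  "fin_equiv X Y \<longleftrightarrow> finitely_representable X Y \<and> finitely_representable Y X"

definition fin_class :: "('v::real_vector) nspace \<Rightarrow> 'v nspace set" where
  "fin_class X = {Y. banach_space Y \<and> fin_equiv Y X}"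

text \<open>
  The set attached to a class of finite equivalence is computed from an arbitrary representative;
  it does not depend on the choice, see \<open>minkowski_of_fin_class\<close> below.
\<close>

definition minkowski_of :: "('v::real_vector) nspace set \<Rightarrow> minkowski set" where
  "minkowski_of K = closure (subspaces_of (SOME Y. Y \<in> K))"

lemma bm_dist_isometric_le:
  assumes sA': "subspace (vecs A')"
    and A: "isometric A' A" and B: "isometric B B'"
  shows "bm_dist A' B' \<le> bm_dist A B"
  unfolding bm_dist_def
proof (rule Inf_greatest, clarify)
  fix u assume "isomorphism A B u"
  then have ub: "bij_betw u (vecs A) (vecs B)" and ul: "linear_on (vecs A) u"
    and ubd: "\<exists>K. \<forall>x\<in>vecs A. nrm B (u x) \<le> K * nrm A x"
    and vbd: "\<exists>K. \<forall>x\<in>vecs B. nrm A (op_inv A u x) \<le> K * nrm B x"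
    unfolding isomorphism_def bounded_op_def by auto
  obtain w where w: "bij_betw w (vecs A') (vecs A)" "linear_on (vecs A') w"
    "\<And>x. x \<in> vecs A' \<Longrightarrow> nrm A (w x) = nrm A' x"
    using A unfolding isometric_def by blast
  obtain v where v: "bij_betw v (vecs B) (vecs B')" "linear_on (vecs B) v"
    "\<And>x. x \<in> vecs B \<Longrightarrow> nrm B' (v x) = nrm B x"
    using B unfolding isometric_def by blast
  define t where "t x = v (u (w x))" for x
  have wim: "vecs A = w ` vecs A'" and uim: "vecs B = u ` vecs A" and vim: "vecs B' = v ` vecs B"
    using w(1) ub v(1) by (auto simp: bij_betw_def)
  have tb: "bij_betw t (vecs A') (vecs B')"
    using bij_betw_trans[OF bij_betw_trans[OF w(1) ub] v(1)] by (simp add: t_def[abs_def] comp_def)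
  have uw: "u (w x) \<in> vecs B" if "x \<in> vecs A'" for x using that wim uim by auto
  have tl: "linear_on (vecs A') t"
    unfolding t_def[abs_def]
    using linear_on_comp[OF linear_on_comp[OF w(2) _ ul] _ v(2)] wim uim by fastforce
  have tn: "nrm B' (t x) = nrm B (u (w x))" if "x \<in> vecs A'" for x
    using v(3)[OF uw[OF that]] by (simp add: t_def)
  have inv: "op_inv A' t (v b) \<in> vecs A' \<and> w (op_inv A' t (v b)) = op_inv A u b" if b: "b \<in> vecs B" for b
  proof -
    let ?z = "op_inv A' t (v b)"
    have "v b \<in> t ` vecs A'" using tb vim b by (simp add: bij_betw_def)
    then have z: "?z \<in> vecs A'" "t ?z = v b" by (auto simp: inv_into_into f_inv_into_f)
    then have "u (w ?z) = b"
      using v(1) b uw[OF z(1)] unfolding t_def bij_betw_def inj_on_def by blast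
    then have "op_inv A u b = w ?z"
      using ub z(1) wim by (metis bij_betw_imp_inj_on imageI inv_into_f_f)
    with z show ?thesis by simp
  qed
  have invn: "nrm A' (op_inv A' t (v b)) = nrm A (op_inv A u b)" if "b \<in> vecs B" for b
    using inv[OF that] w(3) by metis
  have iso: "isomorphism A' B' t"
    unfolding isomorphism_def bounded_op_def
  proof (intro conjI)
    show "linear_on (vecs B') (op_inv A' t)" by (rule linear_on_inv_into[OF sA' tl tb])
    show "t ` vecs A' \<subseteq> vecs B'" using tb by (simp add: bij_betw_def)
    show "op_inv A' t ` vecs B' \<subseteq> vecs A'" using inv vim by auto
    obtain K where "\<forall>x\<in>vecs A. nrm B (u x) \<le> K * nrm A x" using ubd by blast
    then have "\<forall>x\<in>vecs A'. nrm B' (t x) \<le> K * nrm A' x"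
      using tn w(3) wim by (metis imageI)
    then show "\<exists>K. \<forall>x\<in>vecs A'. nrm B' (t x) \<le> K * nrm A' x" by blast
    obtain K where K: "\<forall>x\<in>vecs B. nrm A (op_inv A u x) \<le> K * nrm B x" using vbd by blast
    have "nrm A' (op_inv A' t y) \<le> K * nrm B' y" if y: "y \<in> vecs B'" for y
    proof -
      obtain b where "b \<in> vecs B" "y = v b" using y vim by blast
      then show ?thesis using K invn v(3) by simp
    qed
    then show "\<exists>K. \<forall>x\<in>vecs B'. nrm A' (op_inv A' t x) \<le> K * nrm B' x" by blast
  qed (use tb tl in auto)
  have "{nrm B' (t x) |x. x \<in> vecs A' \<and> nrm A' x \<le> 1} = {nrm B (u x) |x. x \<in> vecs A \<and> nrm A x \<le> 1}"
    (is "?L = ?R")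
  proof
    show "?L \<subseteq> ?R" using tn w(3) wim by (smt (verit) Collect_mono imageI)
    show "?R \<subseteq> ?L"
    proof
      fix r assume "r \<in> ?R"
      then obtain x where x: "x \<in> vecs A" "nrm A x \<le> 1" "r = nrm B (u x)" by blast
      obtain x' where "x' \<in> vecs A'" "x = w x'" using x(1) wim by blast
      then have "x' \<in> vecs A'" "nrm A' x' \<le> 1" "r = nrm B' (t x')" using x tn w(3) by auto
      then show "r \<in> ?L" by blast
    qed
  qed
  then have 1: "opnorm A' B' t = opnorm A B u" unfolding opnorm_def by simp
  have "{nrm A' (op_inv A' t x) |x. x \<in> vecs B' \<and> nrm B' x \<le> 1} = {nrm A (op_inv A u x) |x. x \<in> vecs B \<and> nrm B x \<le> 1}"
    (is "?L = ?R")
  proof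
    show "?L \<subseteq> ?R"
    proof
      fix r assume "r \<in> ?L"
      then obtain x where x: "x \<in> vecs B'" "nrm B' x \<le> 1" "r = nrm A' (op_inv A' t x)" by blast
      obtain b where "b \<in> vecs B" "x = v b" using x(1) vim by blast
      then show "r \<in> ?R" using x invn v(3) by auto
    qed
    show "?R \<subseteq> ?L"
    proof
      fix r assume "r \<in> ?R"
      then obtain b where b: "b \<in> vecs B" "nrm B b \<le> 1" "r = nrm A (op_inv A u b)" by blast
      then have "v b \<in> vecs B'" "nrm B' (v b) \<le> 1" "r = nrm A' (op_inv A' t (v b))"
        using invn v(3) vim by auto
      then show "r \<in> ?L" by blast
    qed
  qed
  then have 2: "opnorm B' A' (op_inv A' t) = opnorm B A (op_inv A u)" unfolding opnorm_def by simp
  show "Inf {ereal (opnorm A' B' u * opnorm B' A' (op_inv A' u)) |u. isomorphism A' B' u}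
      \<le> ereal (opnorm A B u * opnorm B A (op_inv A u))"
    by (rule Inf_lower, rule CollectI, rule exI[of _ t]) (simp add: iso 1 2)
qed

lemma fin_dim_copy:
  fixes X :: "('v::real_vector) nspace"
  assumes X: "normed_space X" and fd: "fin_dim (vecs X)" and ne: "vecs X \<noteq> {0}"
  shows "\<exists>A. isometric (rep_minkowski A) X"
proof -
  obtain S where S: "finite S" "vecs X = span S" using fd unfolding fin_dim_def by blast
  obtain T where T: "T \<subseteq> S" "independent T" "span T = span S"
    by (metis maximal_independent_subset span_eq span_superset subset_trans)
  have fT: "finite T" using T(1) S(1) finite_subset by blast
  obtain i :: "'v \<Rightarrow> nat" where i: "inj_on i T"
    using finite_imp_inj_to_nat_seg[OF fT] by blast
  let ?e = "\<lambda>n. Poly_Mapping.single n (1::real)"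
  obtain g :: "'v \<Rightarrow> (nat \<Rightarrow>\<^sub>0 real)" where g: "linear g" "\<forall>x\<in>T. g x = ?e (i x)"
    using linear_independent_extend[OF T(2), of "\<lambda>x. ?e (i x)"] by blast
  have lk: "Poly_Mapping.lookup (\<Sum>a\<in>T. c a *\<^sub>R ?e (i a)) (i x) = c x" if "x \<in> T" for c x
  proof -
    have "Poly_Mapping.lookup (\<Sum>a\<in>T. c a *\<^sub>R ?e (i a)) (i x)
        = (\<Sum>a\<in>T. Poly_Mapping.lookup (c a *\<^sub>R ?e (i a)) (i x))"
      by (simp add: lookup_sum)
    also have "\<dots> = (\<Sum>a\<in>T. if a = x then c a else 0)"
    proof (rule sum.cong[OF refl])
      fix a assume "a \<in> T"
      then have "i a = i x \<longleftrightarrow> a = x" using i that by (auto simp: inj_on_def)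
      moreover have "Poly_Mapping.lookup (c a *\<^sub>R ?e (i a)) (i x) = c a * Poly_Mapping.lookup (?e (i a)) (i x)"
        by (simp add: scaleR_poly_mapping_def)
      ultimately show "Poly_Mapping.lookup (c a *\<^sub>R ?e (i a)) (i x) = (if a = x then c a else 0)"
        by (simp add: lookup_single when_def)
    qed
    also have "\<dots> = c x" using fT that by simp
    finally show ?thesis .
  qed
  have inj: "inj_on g (vecs X)"
  proof (rule linear_inj_on_iff_eq_0[THEN iffD2, OF g(1)])
    show "subspace (vecs X)" using S by simp
    show "\<forall>x\<in>vecs X. g x = 0 \<longrightarrow> x = 0"
    proof (intro ballI impI)
      fix x assume "x \<in> vecs X" "g x = 0"
      then have "x \<in> range (\<lambda>c. \<Sum>a\<in>T. c a *\<^sub>R a)" using S(2) T(3) span_finite[OF fT] by metis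
      then obtain c where c: "x = (\<Sum>a\<in>T. c a *\<^sub>R a)" by blast
      have "g x = (\<Sum>a\<in>T. c a *\<^sub>R ?e (i a))"
        unfolding c linear_sum[OF g(1)] using g by (simp add: linear_scale)
      then have "c a = 0" if "a \<in> T" for a using lk[OF that, of c] \<open>g x = 0\<close> by simp
      then show "x = 0" using c by simp
    qed
  qed
  define A where "A = \<lparr>vecs = g ` vecs X, nrm = \<lambda>y. nrm X (inv_into (vecs X) g y)\<rparr>"
  have An: "nrm A (g x) = nrm X x" if "x \<in> vecs X" for x
    using that inj by (simp add: A_def)
  have Av: "vecs A = g ` vecs X" by (simp add: A_def)
  note sub = normed_spaceD(1)[OF X]
  have "isometric X A"
    unfolding isometric_def
  proof (intro exI conjI)
    show "bij_betw g (vecs X) (vecs A)" using inj by (simp add: bij_betw_def Av)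
    show "linear_on (vecs X) g" using g(1) by (simp add: linear_on_def linear_add linear_scale)
  qed (use An in auto)
  then have iso: "isometric A X" by (rule isometric_sym[OF sub])
  have nA: "normed_space A"
    unfolding normed_space_def Av ball_simps
  proof (intro conjI ballI allI)
    show "subspace (g ` vecs X)" by (rule linear_subspace_image[OF g(1) sub])
    fix x assume x: "x \<in> vecs X"
    show "0 \<le> nrm A (g x)" using An x normed_spaceD(2)[OF X] by simp
    have "g x = 0 \<longleftrightarrow> x = 0" using inj x sub g(1) by (metis inj_on_def linear_0 subspace_0)
    then show "nrm A (g x) = 0 \<longleftrightarrow> g x = 0" using An x normed_spaceD(3)[OF X] by simp
    fix c
    show "nrm A (c *\<^sub>R g x) = \<bar>c\<bar> * nrm A (g x)"
      using An[OF x] An[of "c *\<^sub>R x"] x sub normed_spaceD(4)[OF X]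
      by (simp add: linear_scale[OF g(1)] subspace_scale)
  next
    fix x y assume x: "x \<in> vecs X" and y: "y \<in> vecs X"
    show "nrm A (g x + g y) \<le> nrm A (g x) + nrm A (g y)"
      using An[OF x] An[OF y] An[of "x + y"] x y sub normed_spaceD(5)[OF X x y]
      by (simp add: linear_add[OF g(1)] subspace_add)
  qed
  have fA: "fin_dim (vecs A)"
    unfolding fin_dim_def Av S(2) using S(1) linear_span_image[OF g(1), of S] by (metis finite_imageI)
  have neA: "vecs A \<noteq> {0}"
  proof -
    obtain x where x: "x \<in> vecs X" "x \<noteq> 0" using ne sub subspace_0 by blast
    then have "g x \<noteq> 0" using inj sub g(1) by (metis inj_on_def linear_0 subspace_0)
    then show ?thesis using x Av by auto
  qed
  have "fd_isometric A A"
    unfolding fd_isometric_def using banach_space_fin_dim[OF nA fA] fA neA isometric_refl by blast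
  then have "fd_isometric (rep_minkowski (abs_minkowski A)) A"
    by (rule rep_abs_rsp_left[OF Quotient3_minkowski])
  then show ?thesis unfolding fd_isometric_def using isometric_trans iso by blast
qed

lemma rep_minkowski_fd:
  "banach_space (rep_minkowski A)" "fin_dim (vecs (rep_minkowski A))" "vecs (rep_minkowski A) \<noteq> {0}"
  using Quotient3_rep_reflp[OF Quotient3_minkowski, of A] unfolding fd_isometric_def by auto

lemma finitely_representable_refl:
  assumes X: "normed_space X"
  shows "finitely_representable X X"
  unfolding finitely_representable_def
proof (intro allI impI)
  fix e :: real and A assume e: "e > 0" and A: "fd_subspace A X"
  let ?Y = "restr X A"
  have sA: "subspace A" using A by (simp add: fd_subspace_def fin_dim_subspace)
  have AX: "A \<subseteq> vecs X" using A by (simp add: fd_subspace_def)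
  have id: "op_inv ?Y (\<lambda>x. x) x = x" if "x \<in> A" for x
    using inv_into_f_f[of "\<lambda>x. x" A x] that by simp
  have lin: "linear_on A (op_inv ?Y (\<lambda>x. x))"
    using linear_on_inv_into[OF sA, of "\<lambda>x. x" A] by (simp add: linear_on_def bij_betw_def)
  have iso: "isomorphism ?Y ?Y (\<lambda>x. x)"
    unfolding isomorphism_def bounded_op_def using lin id
    by (auto simp: linear_on_def bij_betw_def intro!: exI[of _ 1])
  have "opnorm ?Y ?Y (op_inv ?Y (\<lambda>x. x)) = opnorm ?Y ?Y (\<lambda>x. x)"
    unfolding opnorm_def by (rule arg_cong[where f = Sup]) (use id in force)
  moreover have "0 \<le> opnorm ?Y ?Y (\<lambda>x. x)" "opnorm ?Y ?Y (\<lambda>x. x) \<le> 1"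
  proof -
    have n0: "nrm X 0 = 0" using normed_spaceD(1,3)[OF X] subspace_0 by blast
    have mem: "0 \<in> {nrm X x |x. x \<in> A \<and> nrm X x \<le> 1}"
      using n0 sA subspace_0 by force
    show "0 \<le> opnorm ?Y ?Y (\<lambda>x. x)"
      unfolding opnorm_def by (rule cSup_upper) (use mem in \<open>auto simp: bdd_above_def\<close>)
    show "opnorm ?Y ?Y (\<lambda>x. x) \<le> 1"
      unfolding opnorm_def by (rule cSup_least) (use mem in auto)
  qed
  ultimately have "opnorm ?Y ?Y (\<lambda>x. x) * opnorm ?Y ?Y (op_inv ?Y (\<lambda>x. x)) < 1 + e"
    using e mult_le_one[of "opnorm ?Y ?Y (\<lambda>x. x)" "opnorm ?Y ?Y (\<lambda>x. x)"] by simp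
  with A iso show "\<exists>B u. fd_subspace B X \<and> isomorphism ?Y (restr X B) u \<and>
      opnorm ?Y (restr X B) u * opnorm (restr X B) ?Y (op_inv ?Y u) < 1 + e" by blast
qed

lemma subspaces_of_finitely_representable:
  assumes X: "normed_space X" and Y: "normed_space Y" and fr: "finitely_representable X Y"
  shows "subspaces_of X \<subseteq> closure (subspaces_of Y)"
proof
  fix A assume "A \<in> subspaces_of X"
  then obtain B where B: "fd_subspace B X" "B \<noteq> {0}" "isometric (rep_minkowski A) (restr X B)"
    unfolding subspaces_of_def by blast
  have sB: "subspace B" using B by (simp add: fd_subspace_def fin_dim_subspace)
  have "\<exists>M\<in>subspaces_of Y. M \<in> U" if U: "open U" "A \<in> U" for U
  proof -
    obtain e where e: "e > 0" "\<And>M. mdist A M < ereal (exp e) \<Longrightarrow> M \<in> U"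
      using U unfolding open_minkowski_def by blast
    obtain C u where C: "fd_subspace C Y" and u: "isomorphism (restr X B) (restr Y C) u"
      and ud: "opnorm (restr X B) (restr Y C) u * opnorm (restr Y C) (restr X B) (op_inv (restr X B) u)
             < 1 + (exp e - 1)"
      using fr[unfolded finitely_representable_def, rule_format, of "exp e - 1" B] e(1) B(1) by auto
    have sC: "subspace C" using C by (simp add: fd_subspace_def fin_dim_subspace)
    have C0: "C \<noteq> {0}"
    proof
      assume "C = {0}"
      then have ub: "bij_betw u B {0}" using u by (simp add: isomorphism_def)
      then have "x = 0" if "x \<in> B" for x
        using that sB subspace_0[OF sB] unfolding bij_betw_def inj_on_def by (metis imageI singletonD)
      then show False using B(2) subspace_0[OF sB] by blast
    qed
    have "normed_space (restr Y C)"
      using normed_space_restr[OF Y sC] C by (simp add: fd_subspace_def)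
    then obtain M where M: "isometric (rep_minkowski M) (restr Y C)"
      using fin_dim_copy[of "restr Y C"] C C0 by (auto simp: fd_subspace_def)
    have sub: "subspace (vecs (rep_minkowski N))" for N
      by (rule fin_dim_subspace[OF rep_minkowski_fd(2)])
    have "mdist A M \<le> bm_dist (restr X B) (restr Y C)"
      unfolding mdist_def
      by (rule bm_dist_isometric_le[OF sub B(3) isometric_sym[OF sub M]])
    also have "\<dots> \<le> ereal (opnorm (restr X B) (restr Y C) u
        * opnorm (restr Y C) (restr X B) (op_inv (restr X B) u))"
      unfolding bm_dist_def by (rule Inf_lower) (use u in blast)
    also have "\<dots> < ereal (exp e)" using ud by simp
    finally have "M \<in> U" by (rule e(2))
    moreover have "M \<in> subspaces_of Y" unfolding subspaces_of_def using C C0 M by blast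
    ultimately show ?thesis by blast
  qed
  then show "A \<in> closure (subspaces_of Y)" unfolding closure_iff_nhds_not_empty by blast
qed

lemma minkowski_of_fin_class:
  assumes "banach_space X"
  shows "minkowski_of (fin_class X) = closure (subspaces_of X)"
proof -
  have nX: "normed_space X" using assms by (simp add: banach_space_def)
  have "X \<in> fin_class X"
    using assms finitely_representable_refl[OF nX] by (simp add: fin_class_def fin_equiv_def)
  then have Y: "(SOME Y. Y \<in> fin_class X) \<in> fin_class X" (is "?Y \<in> _") by (rule someI)
  then have nY: "normed_space ?Y" and f: "finitely_representable ?Y X" "finitely_representable X ?Y"
    by (auto simp: fin_class_def fin_equiv_def banach_space_def)
  have "closure (subspaces_of ?Y) = closure (subspaces_of X)"
    using subspaces_of_finitely_representable[OF nY nX f(1)]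
      subspaces_of_finitely_representable[OF nX nY f(2)]
    by (intro equalityI closure_minimal) auto
  then show ?thesis unfolding minkowski_of_def .
qed

end

theory Submission
  imports Defs "HOL-Library.Function_Algebras"
begin

text \<open>
  Write \<open>H(X)\<close> for the set of isometry classes of nonzero finite-dimensional subspaces of \<open>X\<close>. The
  class of \<open>A\<close> lies in \<open>H(X)\<close> iff \<open>A\<close> embeds isometrically into \<open>X\<close>, and in the closure of \<open>H(X)\<close>
  iff \<open>A\<close> embeds into \<open>X\<close> with every distortion \<open>r > 1\<close> (\<open>closure_subspaces_of\<close>). Everything is
  therefore said in terms of embeddings of given distortion, which compose, and both directions
  rest on one construction, an ultraproduct \<open>U\<close> of a sequence \<open>Z\<^sub>0, Z\<^sub>1, \<dots>\<close> of normed spaces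
  (\<open>ultraproduct\<close>): bounded sequences with \<open>s\<^sub>n \<in> Z\<^sub>n\<close>, the seminorm \<open>p(s) = lim \<parallel>s\<^sub>n\<parallel>\<close> along a
  filter on the indices, and the null sequences split off. Three facts about it are used:
  \<^item> \<open>U\<close> is complete;
  \<^item> a finite-dimensional subspace of \<open>U\<close> embeds into some \<open>Z\<^sub>n\<close> with distortion as near to 1 as
    desired, since pointwise convergence of norms is uniform in finite dimension
    (\<open>eventually_embeds\<close>);
  \<^item> linear maps \<open>u\<^sub>n : A \<rightarrow> Z\<^sub>n\<close> with \<open>\<parallel>u\<^sub>n a\<parallel> \<rightarrow> \<parallel>a\<parallel>\<close> for all \<open>a\<close> assemble to an isometric embedding
    of \<open>A\<close> into \<open>U\<close>.

  Necessity. For the constant sequence \<open>Z\<^sub>n = X\<close> the last two facts say that \<open>H(U)\<close> is the closure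
  of \<open>H(X)\<close> (\<open>closure_subspaces_of_attained\<close>). Heredity and directedness then hold because they
  hold for \<open>H\<close> of any single normed space: a subspace of a subspace is a subspace, and two
  subspaces lie in their sum.

  Sufficiency. Sampling norms on integer combinations of a basis maps \<open>N\<close> into a
  second-countable space, so \<open>N\<close> has a countable subset \<open>{a\<^sub>0, a\<^sub>1, \<dots>}\<close> that approximates all its
  members (\<open>countable_approximating_subset\<close>). Condition \<open>(A\<^sub>0)\<close> gives a chain \<open>C\<^sub>0, C\<^sub>1, \<dots>\<close> in \<open>N\<close> in
  which each \<open>C\<^sub>n\<close> embeds into \<open>C\<^sub>n\<^sub>+\<^sub>1\<close> and contains a copy of \<open>a\<^sub>n\<close>. In the ultraproduct \<open>U\<close> of
  this chain every \<open>a\<^sub>m\<close> embeds isometrically, because it embeds into \<open>C\<^sub>n\<close> for all \<open>n \<ge> m\<close>; so \<open>N\<close>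
  lies in the closure of \<open>H(U)\<close>. Conversely a member of \<open>H(U)\<close> is near subspaces of the \<open>C\<^sub>n\<close>,
  which belong to \<open>N\<close> by (H), so it belongs to \<open>N\<close> by (C). Finally \<open>U\<close> has at most continuum many
  vectors, hence a linear copy inside the given ambient space.
\<close>

section \<open>Embeddings with bounded distortion\<close>

text \<open>
  Scaling \<open>u\<close> turns any bound on \<open>\<parallel>u\<parallel> \<parallel>u\<inverse>\<parallel>\<close> into this form with lower constant 1. The map need not be
  onto, so that subspaces of \<open>X\<close> need not be mentioned, and composition multiplies the constants.
\<close>

definition embeds :: "real \<Rightarrow> ('v::real_vector) nspace \<Rightarrow> ('w::real_vector) nspace \<Rightarrow> bool" where
  "embeds r A X \<longleftrightarrow>
     (\<exists>u. linear_on (vecs A) u \<and> u ` vecs A \<subseteq> vecs X \<and>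
          (\<forall>a\<in>vecs A. nrm A a \<le> nrm X (u a) \<and> nrm X (u a) \<le> r * nrm A a))"

lemma linear_on_0:
  assumes "linear_on V u" "subspace V"
  shows "u 0 = 0"
proof -
  have "u (0 *\<^sub>R 0) = 0 *\<^sub>R u 0" using assms subspace_0 unfolding linear_on_def by blast
  then show ?thesis by simp
qed

lemma linear_on_diff:
  assumes "linear_on V u" "subspace V" "x \<in> V" "y \<in> V"
  shows "u (x - y) = u x - u y"
proof -
  have "u (x + (-1) *\<^sub>R y) = u x + u ((-1) *\<^sub>R y)"
    using assms subspace_scale unfolding linear_on_def by blast
  also have "u ((-1) *\<^sub>R y) = (-1) *\<^sub>R u y" using assms unfolding linear_on_def by blast
  finally show ?thesis by simp
qed

lemma linear_on_sum:
  assumes "linear_on V u" "subspace V" "\<And>i. i \<in> I \<Longrightarrow> f i \<in> V"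
  shows "u (\<Sum>i\<in>I. f i) = (\<Sum>i\<in>I. u (f i))"
  using assms(3)
proof (induction I rule: infinite_finite_induct)
  case (insert i I)
  have "(\<Sum>i\<in>I. f i) \<in> V" by (rule subspace_sum[OF assms(2)]) (use insert in auto)
  moreover have "f i \<in> V" using insert by simp
  ultimately show ?case using insert assms(1) unfolding linear_on_def by simp
qed (use linear_on_0[OF assms(1,2)] in auto)

lemma subspace_linear_on_image:
  assumes "linear_on V u" "subspace V"
  shows "subspace (u ` V)"
proof (rule subspaceI)
  show "0 \<in> u ` V" using linear_on_0[OF assms] subspace_0[OF assms(2)] by (metis imageI)
next
  fix x y assume "x \<in> u ` V" "y \<in> u ` V"
  then obtain a b where "a \<in> V" "b \<in> V" "x = u a" "y = u b" by blast
  then show "x + y \<in> u ` V" using assms unfolding linear_on_def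
    by (metis imageI subspace_add)
next
  fix c x assume "x \<in> u ` V"
  then obtain a where "a \<in> V" "x = u a" by blast
  then show "c *\<^sub>R x \<in> u ` V" using assms unfolding linear_on_def
    by (metis imageI subspace_scale)
qed

lemma fin_dim_linear_on_image:
  assumes "linear_on V u" "fin_dim V"
  shows "fin_dim (u ` V)"
proof -
  obtain S where S: "finite S" "V = span S" using assms(2) unfolding fin_dim_def by blast
  note sV = fin_dim_subspace[OF assms(2)]
  have "u ` V = span (u ` S)"
  proof
    show "span (u ` S) \<subseteq> u ` V"
      using S by (intro span_minimal subspace_linear_on_image[OF assms(1) sV]) (auto intro: span_base)
    have "x \<in> V \<and> u x \<in> span (u ` S)" if "x \<in> span S" for x
      using that
    proof (induction rule: span_induct_alt)
      case base
      then show ?case using linear_on_0[OF assms(1) sV] subspace_0[OF sV] span_zero by auto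
    next
      case (step c x y)
      have xV: "x \<in> V" using step S span_base by blast
      have "u (c *\<^sub>R x + y) = c *\<^sub>R u x + u y"
        using assms(1) xV step subspace_scale[OF sV xV] unfolding linear_on_def by simp
      moreover have "u x \<in> span (u ` S)" using step(1) by (intro span_base imageI)
      ultimately show ?case
        using step xV sV by (simp add: span_add span_scale subspace_add subspace_scale)
    qed
    then show "u ` V \<subseteq> span (u ` S)" using S by blast
  qed
  then show ?thesis using S unfolding fin_dim_def by blast
qed

lemma nrm_0:
  assumes "normed_space X"
  shows "nrm X 0 = 0"
  using normed_spaceD(3)[OF assms, of 0] subspace_0[OF normed_spaceD(1)[OF assms]] by simp

lemma rep_minkowski_normed [simp]: "normed_space (rep_minkowski A)"
  using rep_minkowski_fd(1) by (simp add: banach_space_def)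

lemma rep_minkowski_subspace [simp]: "subspace (vecs (rep_minkowski A))"
  by (rule normed_spaceD(1)) simp

lemma rep_minkowski_nonzero:
  obtains a where "a \<in> vecs (rep_minkowski A)" "a \<noteq> 0" "nrm (rep_minkowski A) a > 0"
proof -
  obtain a where a: "a \<in> vecs (rep_minkowski A)" "a \<noteq> 0"
    using rep_minkowski_fd(3)[of A] subspace_0[OF rep_minkowski_subspace[of A]] by blast
  then have "nrm (rep_minkowski A) a > 0"
    using normed_spaceD(2,3)[OF rep_minkowski_normed a(1)] by fastforce
  with a show thesis by (rule that)
qed

lemma embeds_inj_on:
  assumes A: "normed_space A" and X: "normed_space X"
    and u: "linear_on (vecs A) u" "u ` vecs A \<subseteq> vecs X" "\<And>a. a \<in> vecs A \<Longrightarrow> nrm A a \<le> nrm X (u a)"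
  shows "inj_on u (vecs A)"
proof (rule inj_onI)
  fix a b assume ab: "a \<in> vecs A" "b \<in> vecs A" "u a = u b"
  note sA = normed_spaceD(1)[OF A]
  have d: "a - b \<in> vecs A" using ab sA by (simp add: subspace_diff)
  have "u (a - b) = 0" using linear_on_diff[OF u(1) sA ab(1,2)] ab by simp
  moreover have "nrm X 0 = 0" by (rule nrm_0[OF X])
  ultimately have "nrm A (a - b) = 0" using u(3)[OF d] normed_spaceD(2)[OF A d] by simp
  then show "a = b" using normed_spaceD(3)[OF A d] by simp
qed

lemma embeds_trans:
  assumes "embeds r A B" "embeds s B C" "0 \<le> s"
  shows "embeds (r * s) A C"
proof -
  obtain u where u: "linear_on (vecs A) u" "u ` vecs A \<subseteq> vecs B"
    "\<forall>a\<in>vecs A. nrm A a \<le> nrm B (u a) \<and> nrm B (u a) \<le> r * nrm A a"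
    using assms(1) unfolding embeds_def by blast
  obtain v where v: "linear_on (vecs B) v" "v ` vecs B \<subseteq> vecs C"
    "\<forall>a\<in>vecs B. nrm B a \<le> nrm C (v a) \<and> nrm C (v a) \<le> s * nrm B a"
    using assms(2) unfolding embeds_def by blast
  have "nrm A a \<le> nrm C (v (u a)) \<and> nrm C (v (u a)) \<le> r * s * nrm A a" if a: "a \<in> vecs A" for a
  proof -
    have ua: "u a \<in> vecs B" using a u(2) by blast
    have "s * nrm B (u a) \<le> s * (r * nrm A a)" using u(3) a assms(3) by (simp add: mult_left_mono)
    then show ?thesis using u(3) v(3) a ua by (force simp: mult_ac)
  qed
  then show ?thesis
    unfolding embeds_def using linear_on_comp[OF u(1,2) v(1)] u(2) v(2)
    by (intro exI[of _ "\<lambda>a. v (u a)"]) auto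
qed

lemma embeds_mono:
  assumes "embeds r A B" "r \<le> s" "normed_space A"
  shows "embeds s A B"
proof -
  have "r * nrm A a \<le> s * nrm A a" if "a \<in> vecs A" for a
    using normed_spaceD(2)[OF assms(3) that] assms(2) by (simp add: mult_right_mono)
  then show ?thesis using assms(1) unfolding embeds_def by (meson order_trans)
qed

lemma subspaces_of_iff:
  assumes X: "normed_space X"
  shows "A \<in> subspaces_of X \<longleftrightarrow> embeds 1 (rep_minkowski A) X"
proof
  assume "A \<in> subspaces_of X"
  then obtain B where B: "fd_subspace B X" "isometric (rep_minkowski A) (restr X B)"
    unfolding subspaces_of_def by blast
  then obtain u where u: "bij_betw u (vecs (rep_minkowski A)) B" "linear_on (vecs (rep_minkowski A)) u"
    "\<forall>x\<in>vecs (rep_minkowski A). nrm X (u x) = nrm (rep_minkowski A) x"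
    unfolding isometric_def by auto
  have "u ` vecs (rep_minkowski A) \<subseteq> vecs X" using u(1) B(1) by (simp add: fd_subspace_def bij_betw_def)
  with u(2,3) show "embeds 1 (rep_minkowski A) X" unfolding embeds_def by auto
next
  assume "embeds 1 (rep_minkowski A) X"
  then obtain u where u: "linear_on (vecs (rep_minkowski A)) u" "u ` vecs (rep_minkowski A) \<subseteq> vecs X"
    "\<And>a. a \<in> vecs (rep_minkowski A) \<Longrightarrow> nrm X (u a) = nrm (rep_minkowski A) a"
    unfolding embeds_def by fastforce
  have inj: "inj_on u (vecs (rep_minkowski A))"
    by (rule embeds_inj_on[OF _ X u(1,2)]) (use u(3) in auto)
  obtain a where a: "a \<in> vecs (rep_minkowski A)" "a \<noteq> 0" by (rule rep_minkowski_nonzero)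
  have "u a \<noteq> 0"
    using inj a linear_on_0[OF u(1) rep_minkowski_subspace] subspace_0[OF rep_minkowski_subspace]
    by (metis inj_on_def)
  then have ne: "u ` vecs (rep_minkowski A) \<noteq> {0}" using a by blast
  have "fd_subspace (u ` vecs (rep_minkowski A)) X"
    unfolding fd_subspace_def using u(2) fin_dim_linear_on_image[OF u(1) rep_minkowski_fd(2)] by blast
  moreover have "isometric (rep_minkowski A) (restr X (u ` vecs (rep_minkowski A)))"
    unfolding isometric_def using inj u by (intro exI[of _ u]) (auto simp: bij_betw_def)
  ultimately show "A \<in> subspaces_of X" unfolding subspaces_of_def using ne by blast
qed

lemma opnorm_bound:
  assumes X: "normed_space X" and Y: "normed_space Y" and u: "bounded_op X Y u" and x: "x \<in> vecs X"
  shows "nrm Y (u x) \<le> opnorm X Y u * nrm X x"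
proof (cases "x = 0")
  case True
  have "u 0 = 0" using u linear_on_0 normed_spaceD(1)[OF X] unfolding bounded_op_def by blast
  moreover have "nrm X 0 = 0" "nrm Y 0 = 0" using nrm_0 X Y by auto
  ultimately show ?thesis using True by simp
next
  case False
  then have p: "nrm X x > 0" using normed_spaceD(2,3)[OF X x] by fastforce
  obtain K where K: "\<And>x. x \<in> vecs X \<Longrightarrow> nrm Y (u x) \<le> K * nrm X x"
    using u unfolding bounded_op_def by blast
  have lin: "linear_on (vecs X) u" and im: "u ` vecs X \<subseteq> vecs Y" using u unfolding bounded_op_def by auto
  let ?x = "inverse (nrm X x) *\<^sub>R x"
  have x': "?x \<in> vecs X" using x normed_spaceD(1)[OF X] by (simp add: subspace_scale)
  have n1: "nrm X ?x = 1" using p normed_spaceD(4)[OF X x] by simp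
  have "bdd_above {nrm Y (u x) | x. x \<in> vecs X \<and> nrm X x \<le> 1}"
  proof (rule bdd_aboveI)
    fix y assume "y \<in> {nrm Y (u x) | x. x \<in> vecs X \<and> nrm X x \<le> 1}"
    then obtain z where z: "z \<in> vecs X" "nrm X z \<le> 1" "y = nrm Y (u z)" by blast
    have "y \<le> K * nrm X z" using K z by simp
    also have "\<dots> \<le> \<bar>K\<bar> * nrm X z" using normed_spaceD(2)[OF X z(1)] by (simp add: mult_right_mono)
    also have "\<dots> \<le> \<bar>K\<bar> * 1" using z by (intro mult_left_mono) auto
    finally show "y \<le> \<bar>K\<bar>" by simp
  qed
  then have "nrm Y (u ?x) \<le> opnorm X Y u"
    unfolding opnorm_def using x' n1 by (intro cSup_upper) auto
  moreover have "nrm Y (u ?x) = inverse (nrm X x) * nrm Y (u x)"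
    using lin im x p normed_spaceD(4)[OF Y, of "u x"] unfolding linear_on_def by auto
  ultimately have "inverse (nrm X x) * nrm Y (u x) \<le> opnorm X Y u" by simp
  then have "nrm X x * (inverse (nrm X x) * nrm Y (u x)) \<le> nrm X x * opnorm X Y u"
    using p by (intro mult_left_mono) auto
  moreover have "nrm X x * (inverse (nrm X x) * nrm Y (u x)) = nrm Y (u x)" using p by simp
  ultimately show ?thesis by (simp only: mult.commute)
qed

text \<open>
  The scaling that normalizes an isomorphism \<open>u\<close> is by \<open>\<parallel>u\<inverse>\<parallel>\<close>.
\<close>

lemma embeds_of_mdist_less:
  assumes "mdist A B < ereal r"
  shows "embeds r (rep_minkowski A) (rep_minkowski B)"
proof -
  let ?A = "rep_minkowski A" and ?B = "rep_minkowski B"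
  obtain u where u: "isomorphism ?A ?B u" and r: "opnorm ?A ?B u * opnorm ?B ?A (op_inv ?A u) < r"
    using assms unfolding mdist_def bm_dist_def Inf_less_iff by auto
  let ?K = "opnorm ?A ?B u" and ?L = "opnorm ?B ?A (op_inv ?A u)"
  have ub: "bij_betw u (vecs ?A) (vecs ?B)" and bo: "bounded_op ?A ?B u" "bounded_op ?B ?A (op_inv ?A u)"
    using u unfolding isomorphism_def by auto
  have im: "u x \<in> vecs ?B" if "x \<in> vecs ?A" for x using ub that by (auto simp: bij_betw_def)
  have lin: "linear_on (vecs ?A) u" using bo unfolding bounded_op_def by blast
  have up: "nrm ?B (u x) \<le> ?K * nrm ?A x" if "x \<in> vecs ?A" for x
    by (rule opnorm_bound[OF _ _ bo(1) that]) auto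
  have lo: "nrm ?A x \<le> ?L * nrm ?B (u x)" if x: "x \<in> vecs ?A" for x
  proof -
    have "op_inv ?A u (u x) = x" using ub x by (simp add: bij_betw_def)
    then show ?thesis using opnorm_bound[OF _ _ bo(2) im[OF x]] by simp
  qed
  obtain a where a: "a \<in> vecs ?A" "nrm ?A a > 0" by (rule rep_minkowski_nonzero)
  have "?L > 0"
  proof (rule ccontr)
    assume "\<not> ?L > 0"
    then have "?L * nrm ?B (u a) \<le> 0"
      using normed_spaceD(2)[OF rep_minkowski_normed im[OF a(1)]] by (simp add: mult_nonpos_nonneg)
    then show False using lo[OF a(1)] a(2) by simp
  qed
  have "nrm ?A x \<le> nrm ?B (?L *\<^sub>R u x) \<and> nrm ?B (?L *\<^sub>R u x) \<le> r * nrm ?A x" if x: "x \<in> vecs ?A" for x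
  proof -
    have eq: "nrm ?B (?L *\<^sub>R u x) = ?L * nrm ?B (u x)"
      using normed_spaceD(4)[OF rep_minkowski_normed im[OF x]] \<open>?L > 0\<close> by simp
    have "?L * nrm ?B (u x) \<le> ?L * (?K * nrm ?A x)" using up[OF x] \<open>?L > 0\<close> by simp
    also have "\<dots> = (?K * ?L) * nrm ?A x" by simp
    also have "\<dots> \<le> r * nrm ?A x"
      using r normed_spaceD(2)[OF rep_minkowski_normed x] by (intro mult_right_mono) auto
    finally show ?thesis using lo[OF x] eq by simp
  qed
  moreover have "linear_on (vecs ?A) (\<lambda>x. ?L *\<^sub>R u x)"
    using lin unfolding linear_on_def by (auto simp: scaleR_add_right)
  ultimately show ?thesis
    unfolding embeds_def using im
    by (intro exI[of _ "\<lambda>x. ?L *\<^sub>R u x"])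
      (auto intro: subspace_scale[OF rep_minkowski_subspace])
qed

text \<open>
  The point \<open>M\<close> is the class of the image of the embedding.
\<close>

lemma subspace_near_of_embeds:
  assumes X: "normed_space X" and e: "embeds r (rep_minkowski A) X"
  obtains M where "M \<in> subspaces_of X" "mdist A M \<le> ereal r"
proof -
  let ?A = "rep_minkowski A"
  obtain u where u: "linear_on (vecs ?A) u" "u ` vecs ?A \<subseteq> vecs X"
    "\<And>a. a \<in> vecs ?A \<Longrightarrow> nrm ?A a \<le> nrm X (u a)" "\<And>a. a \<in> vecs ?A \<Longrightarrow> nrm X (u a) \<le> r * nrm ?A a"
    using e unfolding embeds_def by auto
  let ?B = "restr X (u ` vecs ?A)"
  have inj: "inj_on u (vecs ?A)" by (rule embeds_inj_on[OF _ X u(1-3)]) auto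
  have bij: "bij_betw u (vecs ?A) (vecs ?B)" using inj by (simp add: bij_betw_def)
  have inv: "op_inv ?A u (u a) = a" if "a \<in> vecs ?A" for a using inj that by simp
  obtain a where a: "a \<in> vecs ?A" "a \<noteq> 0" "nrm ?A a > 0" by (rule rep_minkowski_nonzero)
  have "1 * nrm ?A a \<le> r * nrm ?A a" using u(3,4)[OF a(1)] by simp
  then have r: "1 \<le> r" using a(3) by (simp only: mult_le_cancel_right)
  have u0: "u 0 = 0" by (rule linear_on_0[OF u(1)]) simp
  have "u a \<noteq> 0" using inj a u0 subspace_0[OF rep_minkowski_subspace] by (metis inj_on_def)
  then have ne: "vecs ?B \<noteq> {0}" using a by auto
  have fd: "fin_dim (vecs ?B)" using fin_dim_linear_on_image[OF u(1) rep_minkowski_fd(2)] by simp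
  have nB: "normed_space ?B"
    using normed_space_restr[OF X fin_dim_subspace[OF fd]] u(2) by simp
  have iso: "isomorphism ?A ?B u"
    unfolding isomorphism_def bounded_op_def
  proof (intro conjI bij u(1) linear_on_inv_into[OF _ u(1) bij])
    show "\<exists>K. \<forall>x\<in>vecs ?A. nrm ?B (u x) \<le> K * nrm ?A x" using u(4) by auto
    show "\<exists>K. \<forall>x\<in>vecs ?B. nrm ?A (op_inv ?A u x) \<le> K * nrm ?B x"
      using u(3) inv by (intro exI[of _ 1]) auto
  qed (use inv in auto)
  have nz: "0 \<in> vecs ?A" "nrm ?A 0 = 0"
    using subspace_0[OF rep_minkowski_subspace] normed_spaceD(3)[OF rep_minkowski_normed, of 0 A] by auto
  have n0: "nrm X 0 = 0" by (rule nrm_0[OF X])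
  have 1: "opnorm ?A ?B u \<le> r"
    unfolding opnorm_def
  proof (rule cSup_least)
    show "{nrm ?B (u x) |x. x \<in> vecs ?A \<and> nrm ?A x \<le> 1} \<noteq> {}" using nz by force
    fix y assume "y \<in> {nrm ?B (u x) |x. x \<in> vecs ?A \<and> nrm ?A x \<le> 1}"
    then obtain x where x: "x \<in> vecs ?A" "nrm ?A x \<le> 1" "y = nrm X (u x)" by auto
    have "y \<le> r * nrm ?A x" using u(4) x by simp
    also have "\<dots> \<le> r * 1" using x r by (intro mult_left_mono) auto
    finally show "y \<le> r" by simp
  qed
  let ?S = "{nrm ?A (op_inv ?A u x) |x. x \<in> vecs ?B \<and> nrm ?B x \<le> 1}"
  have S1: "y \<le> 1" if "y \<in> ?S" for y
  proof -
    have "\<exists>z. y = nrm ?A (op_inv ?A u z) \<and> z \<in> vecs ?B \<and> nrm ?B z \<le> 1"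
      by (rule CollectD[OF that])
    then obtain z where z: "z \<in> u ` vecs ?A" "nrm X z \<le> 1" "y = nrm ?A (op_inv ?A u z)" by auto
    from z(1) obtain x where x: "x \<in> vecs ?A" "z = u x" by (rule imageE)
    then have "y = nrm ?A x" using inv[OF x(1)] z(3) by simp
    then show ?thesis using u(3)[OF x(1)] x(2) z(2) by simp
  qed
  have "nrm ?A (op_inv ?A u (u 0)) \<in> ?S" using u0 nz n0 by force
  then have S0: "0 \<in> ?S" using inv nz by simp
  have 2: "opnorm ?B ?A (op_inv ?A u) \<le> 1"
    unfolding opnorm_def using S0 S1 by (intro cSup_least) blast+
  have 3: "0 \<le> opnorm ?B ?A (op_inv ?A u)"
    unfolding opnorm_def using S0 S1 by (intro cSup_upper bdd_aboveI[of _ 1]) blast+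
  obtain M where M: "isometric (rep_minkowski M) ?B" using fin_dim_copy[OF nB fd ne] by blast
  have "mdist A M \<le> bm_dist ?A ?B"
    unfolding mdist_def
    by (rule bm_dist_isometric_le[OF rep_minkowski_subspace isometric_refl isometric_sym[OF rep_minkowski_subspace M]])
  also have "\<dots> \<le> ereal (opnorm ?A ?B u * opnorm ?B ?A (op_inv ?A u))"
    unfolding bm_dist_def by (rule Inf_lower) (use iso in blast)
  also have "opnorm ?A ?B u * opnorm ?B ?A (op_inv ?A u) \<le> r * 1"
    using 1 2 3 r by (intro mult_mono) auto
  finally have "mdist A M \<le> ereal r" by simp
  moreover have "M \<in> subspaces_of X"
    unfolding subspaces_of_def fd_subspace_def using u(2) fd ne M by auto
  ultimately show thesis using that by blast
qed

lemma closure_minkowskiI: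
  assumes "\<And>r. r > 1 \<Longrightarrow> \<exists>M\<in>S. mdist A M \<le> ereal r"
  shows "A \<in> closure S"
  unfolding closure_iff_nhds_not_empty
proof (intro allI impI)
  fix T U assume U: "U \<subseteq> T" "open U" "A \<in> U"
  obtain e where e: "e > 0" "\<And>M. mdist A M < ereal (exp e) \<Longrightarrow> M \<in> U"
    using U unfolding open_minkowski_def by blast
  obtain M where M: "M \<in> S" "mdist A M \<le> ereal (exp (e/2))" using assms[of "exp (e/2)"] e(1) by auto
  note M(2)
  also have "ereal (exp (e/2)) < ereal (exp e)" using e(1) by simp
  finally have "M \<in> U" by (rule e(2))
  then show "S \<inter> T \<noteq> {}" using M U by blast
qed

text \<open>
  The right-hand side is closed because distortions multiply: if \<open>A\<close> does not embed with distortion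
  \<open>r\<close>, then nothing within distance \<open>\<surd>r\<close> of \<open>A\<close> embeds with distortion \<open>\<surd>r\<close>.
\<close>

lemma closure_subspaces_of:
  assumes X: "normed_space X"
  shows "closure (subspaces_of X) = {A. \<forall>r>1. embeds r (rep_minkowski A) X}" (is "_ = ?E")
proof
  show "?E \<subseteq> closure (subspaces_of X)"
  proof
    fix A assume "A \<in> ?E"
    then show "A \<in> closure (subspaces_of X)"
      by (intro closure_minkowskiI) (metis (no_types, lifting) mem_Collect_eq subspace_near_of_embeds[OF X])
  qed
  show "closure (subspaces_of X) \<subseteq> ?E"
  proof (rule closure_minimal)
    show "subspaces_of X \<subseteq> ?E"
      using subspaces_of_iff[OF X] embeds_mono[OF _ _ rep_minkowski_normed] by fastforce
    have "open (- ?E)"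
      unfolding open_minkowski_def
    proof
      fix A assume "A \<in> - ?E"
      then obtain r where r: "r > 1" "\<not> embeds r (rep_minkowski A) X" by auto
      define s where "s = exp (ln r / 2)"
      have s: "s > 1" "s * s = r" using r(1) by (auto simp: s_def exp_add[symmetric])
      have "B \<in> - ?E" if "mdist A B < ereal s" for B
      proof
        assume "B \<in> ?E"
        then have "embeds s (rep_minkowski B) X" using s by blast
        then have "embeds (s * s) (rep_minkowski A) X"
          using embeds_trans[OF embeds_of_mdist_less[OF that], of s X] s(1) by simp
        then show False using r s by simp
      qed
      then show "\<exists>e>0. \<forall>B. mdist A B < ereal (exp e) \<longrightarrow> B \<in> - ?E"
        unfolding s_def using r(1) by (intro exI[of _ "ln r / 2"]) auto
    qed
    then show "closed ?E" by (simp add: closed_def)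
  qed
qed

section \<open>Uniform convergence of norms in finite dimension\<close>

text \<open>
  A basis is a sequence continued by zeros, so that a member of one basis can be matched with the
  member of the same index of another without comparing their lengths.
\<close>

definition fin_basis :: "nat \<Rightarrow> (nat \<Rightarrow> 'v::real_vector) \<Rightarrow> 'v set \<Rightarrow> bool" where
  "fin_basis d b V \<longleftrightarrow>
     V = {\<Sum>i<d. c i *\<^sub>R b i |c. True} \<and>
     (\<forall>c. (\<Sum>i<d. c i *\<^sub>R b i) = 0 \<longrightarrow> (\<forall>i<d. c i = 0)) \<and>
     (\<forall>i\<ge>d. b i = 0)"

text \<open>
  Integer combinations form a countable set that is dense up to scaling. Since all maps involved are
  linear, knowing norms on them is as good as knowing norms on a dense set.
\<close>

definition int_comb :: "(nat \<Rightarrow> 'v::real_vector) \<Rightarrow> int list \<Rightarrow> 'v" where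
  "int_comb b ks = (\<Sum>i<length ks. of_int (ks ! i) *\<^sub>R b i)"

lemma fin_basis_exists:
  assumes "fin_dim V"
  obtains d b where "fin_basis d b V"
proof -
  obtain S where S: "finite S" "V = span S" using assms unfolding fin_dim_def by blast
  obtain T where T: "T \<subseteq> S" "independent T" "span T = span S"
    by (metis maximal_independent_subset span_eq span_superset subset_trans)
  have fT: "finite T" using T(1) S(1) finite_subset by blast
  obtain h where h: "bij_betw h {0..<card T} T" using ex_bij_betw_nat_finite[OF fT] by blast
  define d where "d = card T"
  define b where "b i = (if i < d then h i else 0)" for i
  have h': "bij_betw h {..<d} T" using h by (simp add: d_def lessThan_atLeast0)
  have sum: "(\<Sum>i<d. c i *\<^sub>R b i) = (\<Sum>t\<in>T. c (inv_into {..<d} h t) *\<^sub>R t)" for c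
  proof -
    have "(\<Sum>t\<in>T. c (inv_into {..<d} h t) *\<^sub>R t) = (\<Sum>i<d. c (inv_into {..<d} h (h i)) *\<^sub>R h i)"
      by (rule sum.reindex_bij_betw[OF h', symmetric])
    also have "\<dots> = (\<Sum>i<d. c i *\<^sub>R b i)"
      using h' by (intro sum.cong) (auto simp: b_def bij_betw_def)
    finally show ?thesis by simp
  qed
  have "V = {\<Sum>i<d. c i *\<^sub>R b i |c. True}"
  proof
    show "{\<Sum>i<d. c i *\<^sub>R b i |c. True} \<subseteq> V"
      unfolding sum S(2) T(3)[symmetric] by (auto intro!: span_sum span_scale intro: span_base)
    show "V \<subseteq> {\<Sum>i<d. c i *\<^sub>R b i |c. True}"
    proof
      fix x assume "x \<in> V"
      then have "x \<in> range (\<lambda>c. \<Sum>a\<in>T. c a *\<^sub>R a)" using S(2) T(3) span_finite[OF fT] by metis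
      then obtain c where c: "x = (\<Sum>a\<in>T. c a *\<^sub>R a)" by blast
      have "(\<Sum>i<d. c (h i) *\<^sub>R b i) = (\<Sum>i<d. c (h i) *\<^sub>R h i)" by (intro sum.cong) (auto simp: b_def)
      also have "\<dots> = x" unfolding c by (rule sum.reindex_bij_betw[OF h'])
      finally show "x \<in> {\<Sum>i<d. c i *\<^sub>R b i |c. True}" by force
    qed
  qed
  moreover have "c i = 0" if 0: "(\<Sum>i<d. c i *\<^sub>R b i) = 0" and i: "i < d" for c i
  proof -
    have "c (inv_into {..<d} h t) = 0" if "t \<in> T" for t
      using independentD[OF T(2) fT subset_refl 0[unfolded sum] that] .
    moreover have "h i \<in> T" using h' i by (auto simp: bij_betw_def)
    ultimately have "c (inv_into {..<d} h (h i)) = 0" by blast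
    then show ?thesis using h' i by (simp add: bij_betw_def)
  qed
  ultimately have "fin_basis d b V" unfolding fin_basis_def by (auto simp: b_def)
  then show thesis by (rule that)
qed

lemma fin_basis_mem:
  assumes "fin_basis d b V"
  shows "(\<Sum>i<d. c i *\<^sub>R b i) \<in> V" "b i \<in> V"
proof -
  show 1: "(\<Sum>i<d. c i *\<^sub>R b i) \<in> V" for c using assms unfolding fin_basis_def by blast
  show "b i \<in> V"
  proof (cases "i < d")
    case True
    have "(\<Sum>j<d. (if j = i then 1 else 0) *\<^sub>R b j) = (\<Sum>j<d. if j = i then b j else 0)"
      by (rule sum.cong) auto
    also have "\<dots> = b i" using True by simp
    finally show ?thesis using 1[of "\<lambda>j. if j = i then 1 else 0"] by simp
  next
    case False
    then have "b i = 0" using assms unfolding fin_basis_def by simp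
    then show ?thesis using 1[of "\<lambda>_. 0"] by simp
  qed
qed

lemma fin_basis_zeroD:
  assumes "fin_basis d b V" "(\<Sum>i<d. c i *\<^sub>R b i) = 0" "j < d"
  shows "c j = 0"
  using assms unfolding fin_basis_def by blast

lemma nrm_diff_le:
  assumes X: "normed_space X" and x: "x \<in> vecs X" and y: "y \<in> vecs X"
  shows "\<bar>nrm X x - nrm X y\<bar> \<le> nrm X (x - y)"
proof -
  have d: "x - y \<in> vecs X" "y - x \<in> vecs X" using normed_spaceD(1)[OF X] x y by (auto simp: subspace_diff)
  have "nrm X x \<le> nrm X (x - y) + nrm X y" using normed_spaceD(5)[OF X d(1) y] by simp
  moreover have "nrm X y \<le> nrm X (y - x) + nrm X x" using normed_spaceD(5)[OF X d(2) x] by simp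
  ultimately show ?thesis using nrm_commute[OF X x y] by linarith
qed

lemma nrm_sum_le:
  assumes X: "normed_space X" and f: "\<And>i. i \<in> I \<Longrightarrow> f i \<in> vecs X"
  shows "nrm X (\<Sum>i\<in>I. f i) \<le> (\<Sum>i\<in>I. nrm X (f i))"
  using f
proof (induction I rule: infinite_finite_induct)
  case (insert i I)
  have "(\<Sum>i\<in>I. f i) \<in> vecs X" by (rule subspace_sum[OF normed_spaceD(1)[OF X]]) (use insert in auto)
  then have "nrm X (f i + (\<Sum>i\<in>I. f i)) \<le> nrm X (f i) + nrm X (\<Sum>i\<in>I. f i)"
    using insert by (intro normed_spaceD(5)[OF X]) auto
  moreover have "nrm X (\<Sum>i\<in>I. f i) \<le> (\<Sum>i\<in>I. nrm X (f i))" using insert by simp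
  ultimately show ?case using insert by simp
qed (use nrm_0[OF X] in auto)

text \<open>
  A finite-dimensional subspace is complete, hence it contains every point to which it comes
  arbitrarily close.
\<close>

lemma dist_to_fin_dim_pos:
  assumes X: "normed_space X" and W: "fin_dim W" "W \<subseteq> vecs X" and a: "a \<in> vecs X" "a \<notin> W"
  obtains \<delta> where "\<delta> > 0" "\<And>w. w \<in> W \<Longrightarrow> \<delta> \<le> nrm X (a - w)"
proof -
  have "\<exists>\<delta>>0. \<forall>w\<in>W. \<delta> \<le> nrm X (a - w)"
  proof (rule ccontr)
    assume "\<not> ?thesis"
    then have "\<forall>n::nat. \<exists>w\<in>W. nrm X (a - w) < inverse (real (Suc n))"
      by (metis inverse_positive_iff_positive of_nat_0_less_iff zero_less_Suc not_less)
    then obtain w where w: "\<And>n. w n \<in> W" "\<And>n. nrm X (a - w n) < inverse (real (Suc n))"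
      by metis
    have wX: "w n \<in> vecs X" for n using w W by blast
    have aw: "a - w n \<in> vecs X" for n using normed_spaceD(1)[OF X] a wX by (simp add: subspace_diff)
    have lim: "(\<lambda>n. nrm X (a - w n)) \<longlonglongrightarrow> 0"
    proof (rule tendsto_sandwich[OF _ _ tendsto_const LIMSEQ_inverse_real_of_nat])
      show "\<forall>\<^sub>F n in sequentially. 0 \<le> nrm X (a - w n)"
        by (rule always_eventually) (use normed_spaceD(2)[OF X aw] in auto)
      show "\<forall>\<^sub>F n in sequentially. nrm X (a - w n) \<le> inverse (real (Suc n))"
        by (rule always_eventually) (use w(2) less_imp_le in auto)
    qed
    have ban: "banach_space (restr X W)"
      using banach_space_fin_dim[of "restr X W"] normed_space_restr[OF X fin_dim_subspace[OF W(1)] W(2)] W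
      by simp
    have "\<exists>M. \<forall>m\<ge>M. \<forall>n\<ge>M. nrm X (w m - w n) < e" if e: "e > 0" for e
    proof -
      obtain M where M: "\<And>n. n \<ge> M \<Longrightarrow> nrm X (a - w n) < e/2"
        using order_tendstoD(2)[OF lim, of "e/2"] e unfolding eventually_sequentially by auto
      have "nrm X (w m - w n) < e" if "m \<ge> M" "n \<ge> M" for m n
        using nrm_triangle3[OF X wX a(1) wX, of m n] M[OF that(1)] M[OF that(2)]
          nrm_commute[OF X wX a(1), of m] by linarith
      then show ?thesis by blast
    qed
    then have cauchy: "(\<forall>n. w n \<in> W) \<and> (\<forall>e>0. \<exists>M. \<forall>m\<ge>M. \<forall>n\<ge>M. nrm X (w m - w n) < e)"
      using w(1) by blast
    have restr: "vecs (restr X W) = W" "nrm (restr X W) = nrm X" by simp_all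
    have "\<exists>l\<in>W. (\<lambda>n. nrm X (w n - l)) \<longlonglongrightarrow> 0"
      using ban[unfolded banach_space_def restr, THEN conjunct2, THEN spec[of _ w], THEN mp, OF cauchy] .
    then obtain l where l: "l \<in> W" "(\<lambda>n. nrm X (w n - l)) \<longlonglongrightarrow> 0" by blast
    have lX: "l \<in> vecs X" using l W by blast
    have al: "a - l \<in> vecs X" using normed_spaceD(1)[OF X] a lX by (simp add: subspace_diff)
    have "(\<lambda>n. nrm X (a - w n) + nrm X (w n - l)) \<longlonglongrightarrow> 0" using tendsto_add[OF lim l(2)] by simp
    then have "nrm X (a - l) \<le> 0"
      by (rule LIMSEQ_le_const) (use nrm_triangle3[OF X a(1) wX lX] in blast)
    then have "a - l = 0" using normed_spaceD(2,3)[OF X al] by auto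
    then show False using l a by simp
  qed
  then show thesis using that by blast
qed

text \<open>
  The norm of a vector is at least its \<open>j\<close>-th coordinate, in absolute value, times the distance from
  \<open>b j\<close> to the span of the other basis vectors.
\<close>

lemma coordinates_bounded:
  assumes X: "normed_space X" and b: "fin_basis d b (vecs X)"
  obtains K where "K > 0" "\<And>c j. j < d \<Longrightarrow> \<bar>c j\<bar> \<le> K * nrm X (\<Sum>i<d. c i *\<^sub>R b i)"
proof -
  note sX = normed_spaceD(1)[OF X]
  note bX = fin_basis_mem[OF b]
  have "\<exists>\<delta>>0. \<forall>c. \<bar>c j\<bar> * \<delta> \<le> nrm X (\<Sum>i<d. c i *\<^sub>R b i)" if j: "j < d" for j
  proof -
    let ?W = "span (b ` ({..<d} - {j}))"
    have fW: "fin_dim ?W" unfolding fin_dim_def by (intro exI[of _ "b ` ({..<d} - {j})"]) simp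
    have WX: "?W \<subseteq> vecs X" using bX(2) by (intro span_minimal sX) auto
    have split: "(\<Sum>i<d. c i *\<^sub>R b i) = c j *\<^sub>R b j + (\<Sum>i\<in>{..<d}-{j}. c i *\<^sub>R b i)" for c
      using j by (simp add: sum.remove)
    have inj: "inj_on b ({..<d} - {j})"
    proof (rule inj_onI, rule ccontr)
      fix x y assume xy: "x \<in> {..<d} - {j}" "y \<in> {..<d} - {j}" "b x = b y" "x \<noteq> y"
      let ?c = "\<lambda>i. if i = x then 1 else if i = y then -1 else (0::real)"
      have "(\<Sum>i<d. ?c i *\<^sub>R b i) = (\<Sum>i<d. (if i = x then b x else 0) + (if i = y then - b y else 0))"
        using xy by (intro sum.cong) auto
      also have "\<dots> = 0" using xy by (simp add: sum.distrib)
      finally have "?c x = 0" using xy by (intro fin_basis_zeroD[OF b, of ?c]) auto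
      then show False by simp
    qed
    have "b j \<notin> ?W"
    proof
      assume "b j \<in> ?W"
      then have "b j \<in> range (\<lambda>u. \<Sum>v\<in>b ` ({..<d}-{j}). u v *\<^sub>R v)" by (simp add: span_finite)
      then obtain u where "b j = (\<Sum>v\<in>b ` ({..<d}-{j}). u v *\<^sub>R v)" by blast
      also have "\<dots> = (\<Sum>i\<in>{..<d}-{j}. u (b i) *\<^sub>R b i)" using inj by (simp add: sum.reindex)
      finally have u: "b j = (\<Sum>i\<in>{..<d}-{j}. u (b i) *\<^sub>R b i)" .
      let ?c = "\<lambda>i. if i = j then -1 else u (b i)"
      have "(\<Sum>i<d. ?c i *\<^sub>R b i) = - b j + (\<Sum>i\<in>{..<d}-{j}. ?c i *\<^sub>R b i)" unfolding split by simp
      also have "(\<Sum>i\<in>{..<d}-{j}. ?c i *\<^sub>R b i) = (\<Sum>i\<in>{..<d}-{j}. u (b i) *\<^sub>R b i)"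
        by (intro sum.cong) auto
      finally have "(\<Sum>i<d. ?c i *\<^sub>R b i) = 0" using u by simp
      then have "?c j = 0" by (rule fin_basis_zeroD[OF b _ j])
      then show False by simp
    qed
    then obtain \<delta> where \<delta>: "\<delta> > 0" "\<And>w. w \<in> ?W \<Longrightarrow> \<delta> \<le> nrm X (b j - w)"
      using dist_to_fin_dim_pos[OF X fW WX bX(2)] by metis
    have "\<bar>c j\<bar> * \<delta> \<le> nrm X (\<Sum>i<d. c i *\<^sub>R b i)" for c
    proof (cases "c j = 0")
      case True
      then show ?thesis using normed_spaceD(2)[OF X bX(1)] by simp
    next
      case False
      let ?w = "(- 1 / c j) *\<^sub>R (\<Sum>i\<in>{..<d}-{j}. c i *\<^sub>R b i)"
      have w: "?w \<in> ?W" by (intro span_scale span_sum span_base imageI)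
      have "(\<Sum>i<d. c i *\<^sub>R b i) = c j *\<^sub>R (b j - ?w)"
        unfolding split using False by (simp add: algebra_simps)
      then have "nrm X (\<Sum>i<d. c i *\<^sub>R b i) = \<bar>c j\<bar> * nrm X (b j - ?w)"
        using normed_spaceD(4)[OF X, of "b j - ?w" "c j"] bX(2) w WX sX
        by (metis subsetD subspace_diff)
      moreover have "\<bar>c j\<bar> * \<delta> \<le> \<bar>c j\<bar> * nrm X (b j - ?w)" by (intro mult_left_mono \<delta> w) simp
      ultimately show ?thesis by simp
    qed
    then show ?thesis using \<delta>(1) by blast
  qed
  then obtain \<delta> where \<delta>: "\<And>j. j < d \<Longrightarrow> \<delta> j > 0"
    "\<And>j c. j < d \<Longrightarrow> \<bar>c j\<bar> * \<delta> j \<le> nrm X (\<Sum>i<d. c i *\<^sub>R b i)" by metis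
  define K where "K = 1 + (\<Sum>j<d. 1 / \<delta> j)"
  have nn: "0 \<le> (\<Sum>j<d. 1 / \<delta> j)" using \<delta>(1) by (intro sum_nonneg) (auto intro: less_imp_le)
  have "\<bar>c j\<bar> \<le> K * nrm X (\<Sum>i<d. c i *\<^sub>R b i)" if j: "j < d" for c j
  proof -
    let ?n = "nrm X (\<Sum>i<d. c i *\<^sub>R b i)"
    have "1 / \<delta> j \<le> (\<Sum>j<d. 1 / \<delta> j)"
      using j \<delta>(1) by (intro member_le_sum) (auto intro: less_imp_le)
    then have 1: "1 / \<delta> j \<le> K" unfolding K_def by simp
    have "\<bar>c j\<bar> \<le> (1 / \<delta> j) * ?n" using \<delta>(2)[OF j, of c] \<delta>(1)[OF j] by (simp add: field_simps)
    also have "\<dots> \<le> K * ?n" using 1 normed_spaceD(2)[OF X bX(1)] by (intro mult_right_mono)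
    finally show ?thesis .
  qed
  moreover have "K > 0" using nn unfolding K_def by simp
  ultimately show thesis using that by blast
qed

text \<open>
  A vector \<open>x\<close> of norm 1 has coordinates bounded by some \<open>K\<close>. Rounding them to multiples of \<open>1/L\<close> moves
  \<open>x\<close> to one of finitely many grid points, and eventually the norms are almost preserved on all of
  these at once. The rounding error is a combination of the basis vectors with coefficients at most
  \<open>1/L\<close>, so it is small both before and after applying \<open>T i\<close>, uniformly in \<open>x\<close>.
\<close>

lemma eventually_almost_isometric:
  fixes A :: "('v::real_vector) nspace" and Z :: "'i \<Rightarrow> ('w::real_vector) nspace"
  assumes A: "normed_space A" and b: "fin_basis d b (vecs A)"
    and Z: "\<And>i. normed_space (Z i)"
    and T: "\<And>i. linear_on (vecs A) (T i)" "\<And>i. T i ` vecs A \<subseteq> vecs (Z i)"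
    and lim: "\<And>ks. length ks = d \<Longrightarrow> ((\<lambda>i. nrm (Z i) (T i (int_comb b ks))) \<longlongrightarrow> nrm A (int_comb b ks)) F"
    and \<epsilon>: "\<epsilon> > 0"
  shows "\<forall>\<^sub>F i in F. \<forall>x\<in>vecs A. \<bar>nrm (Z i) (T i x) - nrm A x\<bar> \<le> \<epsilon> * nrm A x"
proof -
  note sA = normed_spaceD(1)[OF A]
  note bA = fin_basis_mem[OF b]
  have TZ: "T i x \<in> vecs (Z i)" if "x \<in> vecs A" for i x using T(2) that by blast
  have Tsc: "T i (c *\<^sub>R x) = c *\<^sub>R T i x" if "x \<in> vecs A" for i c x
    using T(1) that unfolding linear_on_def by blast
  obtain K where K: "K > 0" "\<And>c j. j < d \<Longrightarrow> \<bar>c j\<bar> \<le> K * nrm A (\<Sum>i<d. c i *\<^sub>R b i)"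
    using coordinates_bounded[OF A b] by blast
  define S where "S = (\<Sum>j<d. nrm A (b j))"
  have S0: "S \<ge> 0" unfolding S_def by (intro sum_nonneg normed_spaceD(2)[OF A bA(2)])
  \<comment> \<open>the rounding errors before and after applying the map and the error at the grid point add up to (2S + d + 1) / L\<close>
  obtain L :: nat where L: "(2 * S + d + 1) / \<epsilon> < real L" using reals_Archimedean2 by blast
  have "(2 * S + d + 1) / \<epsilon> > 0" using S0 \<epsilon> by (intro divide_pos_pos) auto
  then have Lp: "real L > 0" using L by linarith
  have L': "(2 * S + d + 1) / L \<le> \<epsilon>" using L Lp \<epsilon> by (simp add: field_simps)
  define M where "M = \<lceil>K * L\<rceil> + 1"
  define grid where "grid = {ks. set ks \<subseteq> {-M..M} \<and> length ks = d}"
  have "finite grid" unfolding grid_def by (intro finite_lists_length_eq) simp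
  then have ev1: "\<forall>\<^sub>F i in F. \<forall>ks\<in>grid. \<bar>nrm (Z i) (T i (int_comb b ks)) - nrm A (int_comb b ks)\<bar> < 1"
    using tendstoD[OF lim, of _ 1] by (intro eventually_ball_finite) (auto simp: dist_real_def grid_def)
  have ev2: "\<forall>\<^sub>F i in F. \<forall>j\<in>{..<d}. nrm (Z i) (T i (b j)) < nrm A (b j) + 1"
  proof (intro eventually_ball_finite ballI finite_lessThan)
    fix j assume "j \<in> {..<d}"
    then have j: "j < d" by simp
    have "int_comb b ((replicate d 0)[j := 1]) = (\<Sum>i<d. if i = j then b j else 0)"
      unfolding int_comb_def by (intro sum.cong) (auto simp: nth_list_update)
    also have "\<dots> = b j" using j by simp
    finally have "int_comb b ((replicate d 0)[j := 1]) = b j" .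
    then have "((\<lambda>i. nrm (Z i) (T i (b j))) \<longlongrightarrow> nrm A (b j)) F"
      using lim[of "(replicate d 0)[j := 1]"] by simp
    then show "\<forall>\<^sub>F i in F. nrm (Z i) (T i (b j)) < nrm A (b j) + 1"
      by (rule order_tendstoD) simp
  qed
  from ev1 ev2 show ?thesis
  proof eventually_elim
    case (elim i)
    have unit: "\<bar>nrm (Z i) (T i x) - 1\<bar> \<le> \<epsilon>" if x: "x \<in> vecs A" "nrm A x = 1" for x
    proof -
      obtain c where c: "x = (\<Sum>j<d. c j *\<^sub>R b j)" using b x(1) unfolding fin_basis_def by auto
      have cK: "\<bar>c j\<bar> \<le> K" if "j < d" for j using K(2)[OF that, of c] x(2) c by simp
      define ks where "ks = map (\<lambda>j. \<lfloor>c j * L\<rfloor>) [0..<d]"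
      have "ks \<in> grid"
      proof -
        have "- M \<le> \<lfloor>c j * L\<rfloor> \<and> \<lfloor>c j * L\<rfloor> \<le> M" if "j < d" for j
        proof -
          have "\<bar>c j * L\<bar> \<le> K * L" using cK[OF that] Lp by (simp add: abs_mult)
          then show ?thesis unfolding M_def by linarith
        qed
        then show ?thesis unfolding grid_def ks_def by auto
      qed
      define e where "e j = c j - \<lfloor>c j * L\<rfloor> / L" for j
      have eb: "\<bar>e j\<bar> \<le> 1 / L" for j
      proof -
        have "e j * L = c j * L - \<lfloor>c j * L\<rfloor>" using Lp unfolding e_def by (simp add: field_simps)
        then have "0 \<le> e j * L" "e j * L \<le> 1" by linarith+
        then show ?thesis using Lp by (simp add: field_simps zero_le_mult_iff)
      qed
      define g where "g = (1 / L) *\<^sub>R int_comb b ks"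
      have g': "g = (\<Sum>j<d. (\<lfloor>c j * L\<rfloor> / L) *\<^sub>R b j)"
        unfolding g_def int_comb_def ks_def scaleR_sum_right by (intro sum.cong) auto
      have xg: "x - g = (\<Sum>j<d. e j *\<^sub>R b j)"
        unfolding c g' e_def by (simp add: sum_subtractf scaleR_diff_left)
      have icA: "int_comb b ks \<in> vecs A"
        unfolding int_comb_def by (intro subspace_sum sA subspace_scale bA)
      have gA: "g \<in> vecs A" unfolding g_def by (intro subspace_scale sA icA)
      have xgA: "x - g \<in> vecs A" unfolding xg by (rule bA)
      have ebA: "e j *\<^sub>R b j \<in> vecs A" for j by (intro subspace_scale sA bA)
      have 1: "nrm A (x - g) \<le> S / L"
      proof -
        have "nrm A (x - g) \<le> (\<Sum>j<d. nrm A (e j *\<^sub>R b j))"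
          unfolding xg using ebA by (intro nrm_sum_le[OF A])
        also have "\<dots> = (\<Sum>j<d. \<bar>e j\<bar> * nrm A (b j))" using normed_spaceD(4)[OF A bA(2)] by simp
        also have "\<dots> \<le> (\<Sum>j<d. (1 / L) * nrm A (b j))"
          using eb normed_spaceD(2)[OF A bA(2)] by (intro sum_mono mult_right_mono)
        finally show ?thesis unfolding S_def by (simp add: sum_divide_distrib)
      qed
      have 2: "nrm (Z i) (T i (x - g)) \<le> (S + d) / L"
      proof -
        have "T i (x - g) = (\<Sum>j<d. T i (e j *\<^sub>R b j))"
          unfolding xg using ebA by (intro linear_on_sum[OF T(1) sA])
        then have "nrm (Z i) (T i (x - g)) \<le> (\<Sum>j<d. nrm (Z i) (T i (e j *\<^sub>R b j)))"
          using nrm_sum_le[OF Z TZ[OF ebA]] by simp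
        also have "\<dots> = (\<Sum>j<d. \<bar>e j\<bar> * nrm (Z i) (T i (b j)))"
          using normed_spaceD(4)[OF Z TZ[OF bA(2)]] Tsc[OF bA(2)] by simp
        also have "\<dots> \<le> (\<Sum>j<d. (1 / L) * (nrm A (b j) + 1))"
          using eb elim(2) normed_spaceD(2)[OF Z TZ[OF bA(2)]]
          by (intro sum_mono mult_mono) (auto intro: less_imp_le)
        also have "\<dots> = (S + d) / L" unfolding S_def sum_distrib_left[symmetric] by (simp add: sum.distrib)
        finally show ?thesis .
      qed
      have 3: "\<bar>nrm (Z i) (T i g) - nrm A g\<bar> \<le> 1 / L"
      proof -
        have "nrm (Z i) (T i g) - nrm A g = (1 / L) * (nrm (Z i) (T i (int_comb b ks)) - nrm A (int_comb b ks))"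
          unfolding g_def Tsc[OF icA] normed_spaceD(4)[OF A icA] normed_spaceD(4)[OF Z TZ[OF icA]]
          using Lp by (simp add: algebra_simps)
        then have "\<bar>nrm (Z i) (T i g) - nrm A g\<bar> = (1 / L) * \<bar>nrm (Z i) (T i (int_comb b ks)) - nrm A (int_comb b ks)\<bar>"
          using Lp by (simp add: abs_mult)
        also have "\<dots> \<le> (1 / L) * 1" using elim(1) \<open>ks \<in> grid\<close> Lp by (intro mult_left_mono) (auto intro: less_imp_le)
        finally show ?thesis by simp
      qed
      have 4: "\<bar>nrm A x - nrm A g\<bar> \<le> S / L" using nrm_diff_le[OF A x(1) gA] 1 by linarith
      have 5: "\<bar>nrm (Z i) (T i x) - nrm (Z i) (T i g)\<bar> \<le> (S + d) / L"
        using nrm_diff_le[OF Z[of i] TZ[OF x(1)] TZ[OF gA]] 2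
        unfolding linear_on_diff[OF T(1) sA x(1) gA] by linarith
      have "\<bar>nrm (Z i) (T i x) - 1\<bar> \<le> (S + d) / L + 1 / L + S / L" using 3 4 5 x(2) by linarith
      also have "\<dots> = (2 * S + d + 1) / L" by (simp add: add_divide_distrib[symmetric])
      finally show ?thesis using L' by linarith
    qed
    show ?case
    proof
      fix x assume x: "x \<in> vecs A"
      show "\<bar>nrm (Z i) (T i x) - nrm A x\<bar> \<le> \<epsilon> * nrm A x"
      proof (cases "x = 0")
        case True
        then show ?thesis using nrm_0[OF A] nrm_0[OF Z] linear_on_0[OF T(1) sA] by simp
      next
        case False
        then have p: "nrm A x > 0" using normed_spaceD(2,3)[OF A x] by fastforce
        let ?y = "(1 / nrm A x) *\<^sub>R x"
        have y: "?y \<in> vecs A" "nrm A ?y = 1"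
          using x sA p normed_spaceD(4)[OF A x] by (auto simp: subspace_scale)
        have "nrm (Z i) (T i ?y) = (1 / nrm A x) * nrm (Z i) (T i x)"
          using Tsc[OF x] normed_spaceD(4)[OF Z TZ[OF x]] p by simp
        then have "\<bar>nrm (Z i) (T i x) / nrm A x - 1\<bar> \<le> \<epsilon>" using unit[OF y] by simp
        moreover have "\<bar>nrm (Z i) (T i x) - nrm A x\<bar> = \<bar>nrm (Z i) (T i x) / nrm A x - 1\<bar> * nrm A x"
        proof -
          have "nrm (Z i) (T i x) - nrm A x = (nrm (Z i) (T i x) / nrm A x - 1) * nrm A x"
            using p by (simp add: field_simps)
          then show ?thesis using p by (simp add: abs_mult)
        qed
        ultimately show ?thesis using p by (simp add: mult_right_mono)
      qed
    qed
  qed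
qed

lemma eventually_embeds:
  fixes A :: "('v::real_vector) nspace" and Z :: "'i \<Rightarrow> ('w::real_vector) nspace"
  assumes A: "normed_space A" and b: "fin_basis d b (vecs A)"
    and Z: "\<And>i. normed_space (Z i)"
    and T: "\<And>i. linear_on (vecs A) (T i)" "\<And>i. T i ` vecs A \<subseteq> vecs (Z i)"
    and lim: "\<And>ks. length ks = d \<Longrightarrow> ((\<lambda>i. nrm (Z i) (T i (int_comb b ks))) \<longlongrightarrow> nrm A (int_comb b ks)) F"
    and r: "r > 1"
  shows "\<forall>\<^sub>F i in F. embeds r A (Z i)"
proof -
  define \<epsilon> where "\<epsilon> = (r - 1) / (r + 1)"
  have \<epsilon>: "\<epsilon> > 0" "\<epsilon> < 1" "1 + \<epsilon> = r * (1 - \<epsilon>)" using r unfolding \<epsilon>_def by (auto simp: field_simps)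
  have "\<forall>\<^sub>F i in F. \<forall>x\<in>vecs A. \<bar>nrm (Z i) (T i x) - nrm A x\<bar> \<le> \<epsilon> * nrm A x"
    by (rule eventually_almost_isometric[OF A b Z T _ \<epsilon>(1)]) (rule lim)
  then show ?thesis
  proof eventually_elim
    case (elim i)
    let ?u = "\<lambda>x. (1 / (1 - \<epsilon>)) *\<^sub>R T i x"
    have "nrm A x \<le> nrm (Z i) (?u x) \<and> nrm (Z i) (?u x) \<le> r * nrm A x" if x: "x \<in> vecs A" for x
    proof -
      have eq: "nrm (Z i) (?u x) = nrm (Z i) (T i x) / (1 - \<epsilon>)"
        using normed_spaceD(4)[OF Z, of "T i x" i] T(2)[of i] x \<epsilon> by (simp add: image_subset_iff)
      have "(1 - \<epsilon>) * nrm A x \<le> nrm (Z i) (T i x)" "nrm (Z i) (T i x) \<le> (r * (1 - \<epsilon>)) * nrm A x"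
        unfolding \<epsilon>(3)[symmetric] using elim x by (fastforce simp: algebra_simps abs_le_iff)+
      then show ?thesis unfolding eq using \<epsilon>(2) by (simp add: field_simps)
    qed
    moreover have "linear_on (vecs A) ?u" using T(1) unfolding linear_on_def by (simp add: scaleR_add_right)
    ultimately show ?case
      unfolding embeds_def using T(2) normed_spaceD(1)[OF Z]
      by (intro exI[of _ ?u]) (auto intro!: subspace_scale)
  qed
qed

section \<open>Ultraproducts of normed spaces\<close>

text \<open>
  By Tychonoff's theorem the family \<open>f\<close>, which takes its values in a product of compact intervals, has
  a cluster point \<open>p\<close> along \<open>F\<close>. The filter \<open>G\<close> is generated by \<open>F\<close> and the preimages of the
  neighbourhoods of \<open>p\<close>; it does the work of an ultrafilter for this one family.
\<close>

lemma pointwise_cluster_filter: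
  fixes f :: "'i \<Rightarrow> 'w \<Rightarrow> real"
  assumes F: "F \<noteq> bot" and bd: "\<And>w. \<exists>K. \<forall>i. \<bar>f i w\<bar> \<le> K"
  obtains G p where "G \<le> F" "G \<noteq> bot" "\<And>w. ((\<lambda>i. f i w) \<longlongrightarrow> p w) G"
proof -
  obtain K where K: "\<And>w i. \<bar>f i w\<bar> \<le> K w" using bd by metis
  let ?U = "PiE UNIV (\<lambda>w. {- K w..K w})"
  have "compactin (product_topology (\<lambda>w. euclidean) UNIV) ?U"
    unfolding compactin_PiE by simp
  then have "compact ?U" unfolding euclidean_product_topology by simp
  moreover have "filtermap f F \<noteq> bot" using F by (simp add: filtermap_bot_iff)
  moreover have "\<forall>\<^sub>F x in filtermap f F. x \<in> ?U"
    unfolding eventually_filtermap using K by (intro always_eventually) (auto simp: abs_le_iff minus_le_iff)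
  ultimately obtain p where p: "inf (nhds p) (filtermap f F) \<noteq> bot"
    unfolding compact_filter by blast
  define G where "G = inf F (filtercomap f (nhds p))"
  have "G \<noteq> bot"
  proof
    assume "G = bot"
    then have "eventually (\<lambda>_. False) G" by simp
    then obtain P Q where P: "eventually P F" and Q: "eventually Q (filtercomap f (nhds p))"
      and PQ: "\<And>x. P x \<Longrightarrow> Q x \<Longrightarrow> False"
      unfolding G_def eventually_inf by blast
    obtain R where R: "eventually R (nhds p)" "\<And>x. R (f x) \<Longrightarrow> Q x"
      using Q unfolding eventually_filtercomap by blast
    have "eventually (\<lambda>y. \<not> R y) (filtermap f F)"
      unfolding eventually_filtermap using P by eventually_elim (use PQ R in blast)
    then have "eventually (\<lambda>_. False) (inf (nhds p) (filtermap f F))"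
      unfolding eventually_inf using R(1) by blast
    then show False using p by (simp add: eventually_False)
  qed
  moreover have "filterlim f (nhds p) G"
    using filterlim_mono[OF filterlim_filtercomap order_refl, of G f "nhds p"] unfolding G_def by simp
  then have "((\<lambda>i. f i w) \<longlongrightarrow> p w) G" for w
    using continuous_on_tendsto_compose[OF continuous_on_product_coordinates[of w], of f p G] by simp
  ultimately show thesis using that[of G p] unfolding G_def by simp
qed

text \<open>
  \<open>\<pi>\<close> projects \<open>V\<close> onto an algebraic complement of \<open>K\<close>. That complement serves as the quotient \<open>V / K\<close>
  without leaving the type of the vectors.
\<close>

lemma complement_projection:
  fixes V K :: "'a::real_vector set"
  assumes V: "subspace V" and K: "subspace K" "K \<subseteq> V"
  obtains \<pi> where "linear \<pi>" "\<And>x. x \<in> V \<Longrightarrow> \<pi> x \<in> V" "\<And>x. x \<in> V \<Longrightarrow> x - \<pi> x \<in> K"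
    "\<And>x. x \<in> K \<Longrightarrow> \<pi> x = 0"
proof -
  obtain BK where BK: "BK \<subseteq> K" "independent BK" "K \<subseteq> span BK"
    using maximal_independent_subset[of K] by blast
  obtain BV where BV: "BK \<subseteq> BV" "BV \<subseteq> V" "independent BV" "V \<subseteq> span BV"
    using maximal_independent_subset_extend[of BK V] BK K by blast
  obtain \<pi> where \<pi>: "linear \<pi>" "\<forall>x\<in>BV. \<pi> x = (if x \<in> BK then 0 else x)"
    using linear_independent_extend[OF BV(3), of "\<lambda>x. if x \<in> BK then 0 else x"] by blast
  have 1: "x - \<pi> x \<in> K" if "x \<in> V" for x
  proof -
    have "x \<in> span BV" using that BV by blast
    then show ?thesis
    proof (induction rule: span_induct_alt)
      case base
      then show ?case using linear_0[OF \<pi>(1)] subspace_0[OF K(1)] by simp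
    next
      case (step c x y)
      have x: "x - \<pi> x \<in> K" using step(1) \<pi>(2) BK(1) subspace_0[OF K(1)] by auto
      have "c *\<^sub>R x + y - \<pi> (c *\<^sub>R x + y) = c *\<^sub>R (x - \<pi> x) + (y - \<pi> y)"
        by (simp add: linear_add[OF \<pi>(1)] linear_scale[OF \<pi>(1)] algebra_simps)
      then show ?case using step x K(1) by (simp only: subspace_add subspace_scale)
    qed
  qed
  have 2: "\<pi> x \<in> V" if "x \<in> V" for x
  proof -
    have "x - (x - \<pi> x) \<in> V" using subspace_diff[OF V that subsetD[OF K(2) 1[OF that]]] .
    then show ?thesis by simp
  qed
  have 3: "\<pi> x = 0" if "x \<in> K" for x
  proof -
    have "x \<in> span BK" using that BK by blast
    then show ?thesis
    proof (induction rule: span_induct_alt)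
      case base
      then show ?case by (rule linear_0[OF \<pi>(1)])
    next
      case (step c x y)
      then show ?case using \<pi>(2) BV(1) by (auto simp: linear_add[OF \<pi>(1)] linear_scale[OF \<pi>(1)])
    qed
  qed
  show thesis by (rule that[OF \<pi>(1) 2 1 3])
qed

instantiation "fun" :: (type, scaleR) scaleR
begin
definition scaleR_fun :: "real \<Rightarrow> ('a \<Rightarrow> 'b) \<Rightarrow> 'a \<Rightarrow> 'b" where
  "scaleR_fun c f = (\<lambda>x. c *\<^sub>R f x)"
instance ..
end

lemma scaleR_fun_apply [simp]: "(c *\<^sub>R f) x = c *\<^sub>R f x"
  by (simp add: scaleR_fun_def)

instance "fun" :: (type, real_vector) real_vector
  by standard (simp_all add: fun_eq_iff algebra_simps)

definition bounded_seqs :: "(nat \<Rightarrow> ('v::real_vector) nspace) \<Rightarrow> (nat \<Rightarrow> 'v) set" where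
  "bounded_seqs Z = {s. (\<forall>n. s n \<in> vecs (Z n)) \<and> (\<exists>K. \<forall>n. nrm (Z n) (s n) \<le> K)}"

lemma bounded_seqs_mem: "s \<in> bounded_seqs Z \<Longrightarrow> s n \<in> vecs (Z n)"
  unfolding bounded_seqs_def by blast

lemma subspace_bounded_seqs:
  assumes Z: "\<And>n. normed_space (Z n)"
  shows "subspace (bounded_seqs Z)"
proof (rule subspaceI)
  note sZ = normed_spaceD(1)[OF Z]
  show "0 \<in> bounded_seqs Z"
    unfolding bounded_seqs_def using nrm_0[OF Z] subspace_0[OF sZ] by auto
  fix s assume s: "s \<in> bounded_seqs Z"
  obtain K where K: "\<And>n. nrm (Z n) (s n) \<le> K" using s unfolding bounded_seqs_def by blast
  {
    fix t assume t: "t \<in> bounded_seqs Z"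
    obtain L where L: "\<And>n. nrm (Z n) (t n) \<le> L" using t unfolding bounded_seqs_def by blast
    have "nrm (Z n) (s n + t n) \<le> K + L" for n
      using normed_spaceD(5)[OF Z bounded_seqs_mem[OF s] bounded_seqs_mem[OF t], of n] K[of n] L[of n]
      by linarith
    moreover have "s n + t n \<in> vecs (Z n)" for n
      by (rule subspace_add[OF sZ bounded_seqs_mem[OF s] bounded_seqs_mem[OF t]])
    ultimately show "s + t \<in> bounded_seqs Z" unfolding bounded_seqs_def by auto
  }
  fix c :: real
  have "nrm (Z n) (c *\<^sub>R s n) \<le> \<bar>c\<bar> * K" for n
    using normed_spaceD(4)[OF Z bounded_seqs_mem[OF s], of n c] K[of n] by (simp add: mult_left_mono)
  moreover have "c *\<^sub>R s n \<in> vecs (Z n)" for n by (rule subspace_scale[OF sZ bounded_seqs_mem[OF s]])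
  ultimately show "c *\<^sub>R s \<in> bounded_seqs Z" unfolding bounded_seqs_def by auto
qed

text \<open>
  The seminorm of an ultraproduct, before the passage to the quotient by its kernel. All that matters
  about \<open>G\<close> is that norms of bounded sequences converge along it, that limits along it are unique, and
  that it refines \<open>sequentially\<close>; the last is what makes the ultraproduct complete.
\<close>

locale norm_limit =
  fixes Z :: "nat \<Rightarrow> ('v::real_vector) nspace" and G :: "nat filter" and p :: "(nat \<Rightarrow> 'v) \<Rightarrow> real"
  assumes Z: "normed_space (Z n)"
    and G: "G \<noteq> bot" "G \<le> sequentially"
    and lim: "s \<in> bounded_seqs Z \<Longrightarrow> ((\<lambda>n. nrm (Z n) (s n)) \<longlongrightarrow> p s) G"
begin

lemma subspace_seqs: "subspace (bounded_seqs Z)"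
  by (rule subspace_bounded_seqs[OF Z])

lemma p_nonneg:
  assumes "s \<in> bounded_seqs Z"
  shows "0 \<le> p s"
  by (rule tendsto_lowerbound[OF lim[OF assms] _ G(1)])
    (rule always_eventually, use normed_spaceD(2)[OF Z bounded_seqs_mem[OF assms]] in blast)

lemma p_scale:
  assumes "s \<in> bounded_seqs Z"
  shows "p (c *\<^sub>R s) = \<bar>c\<bar> * p s"
proof (rule tendsto_unique[OF G(1)])
  show "((\<lambda>n. nrm (Z n) ((c *\<^sub>R s) n)) \<longlongrightarrow> p (c *\<^sub>R s)) G"
    by (rule lim[OF subspace_scale[OF subspace_seqs assms]])
  show "((\<lambda>n. nrm (Z n) ((c *\<^sub>R s) n)) \<longlongrightarrow> \<bar>c\<bar> * p s) G"
    using tendsto_mult_left[OF lim[OF assms], of "\<bar>c\<bar>"] normed_spaceD(4)[OF Z bounded_seqs_mem[OF assms]]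
    by simp
qed

lemma p_triangle:
  assumes "s \<in> bounded_seqs Z" "t \<in> bounded_seqs Z"
  shows "p (s + t) \<le> p s + p t"
proof (rule tendsto_le[OF G(1)])
  show "((\<lambda>n. nrm (Z n) ((s + t) n)) \<longlongrightarrow> p (s + t)) G"
    by (rule lim[OF subspace_add[OF subspace_seqs assms]])
  show "((\<lambda>n. nrm (Z n) (s n) + nrm (Z n) (t n)) \<longlongrightarrow> p s + p t) G"
    by (rule tendsto_add[OF lim[OF assms(1)] lim[OF assms(2)]])
  show "\<forall>\<^sub>F n in G. nrm (Z n) ((s + t) n) \<le> nrm (Z n) (s n) + nrm (Z n) (t n)"
    by (rule always_eventually)
      (use normed_spaceD(5)[OF Z bounded_seqs_mem[OF assms(1)] bounded_seqs_mem[OF assms(2)]] in simp)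
qed

definition kernel :: "(nat \<Rightarrow> 'v) set" where
  "kernel = {s \<in> bounded_seqs Z. p s = 0}"

lemma subspace_kernel: "subspace kernel"
proof (rule subspaceI)
  have "0 \<in> bounded_seqs Z" by (rule subspace_0[OF subspace_seqs])
  moreover have "p 0 = 0" using p_scale[OF calculation, of 0] by simp
  ultimately show "0 \<in> kernel" unfolding kernel_def by simp
next
  fix s t assume "s \<in> kernel" "t \<in> kernel"
  then have st: "s \<in> bounded_seqs Z" "t \<in> bounded_seqs Z" "p s = 0" "p t = 0" unfolding kernel_def by auto
  then have "s + t \<in> bounded_seqs Z" by (intro subspace_add[OF subspace_seqs])
  then show "s + t \<in> kernel"
    using p_triangle[OF st(1,2)] p_nonneg[of "s + t"] st unfolding kernel_def by simp
next
  fix c s assume "s \<in> kernel"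
  then show "c *\<^sub>R s \<in> kernel"
    using p_scale subspace_scale[OF subspace_seqs] unfolding kernel_def by auto
qed

lemma p_cong:
  assumes s: "s \<in> bounded_seqs Z" and t: "t \<in> bounded_seqs Z" and st: "s - t \<in> kernel"
  shows "p s = p t"
proof -
  have "t - s \<in> kernel" using subspace_neg[OF subspace_kernel st] by simp
  then have ts: "t - s \<in> bounded_seqs Z" "p (t - s) = 0" unfolding kernel_def by auto
  have "s - t \<in> bounded_seqs Z" "p (s - t) = 0" using st unfolding kernel_def by auto
  then show ?thesis using p_triangle[OF _ t, of "s - t"] p_triangle[OF ts(1) s] ts(2) by simp
qed

text \<open>
  A diagonal argument. At index \<open>n\<close> one follows the sequence \<open>s 0 n, s 1 n, \<dots>\<close> as long as consecutive
  terms are as close as their seminorms promise, but no further than the \<open>n\<close>-th term. For every \<open>k\<close>,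
  this stage \<open>\<kappa> n\<close> is at least \<open>k\<close> for \<open>G\<close>-almost all \<open>n\<close>, and then \<open>l n\<close> is within a geometric tail of \<open>s k n\<close>.
\<close>

lemma p_complete:
  assumes s: "\<And>k. s k \<in> bounded_seqs Z" and small: "\<And>k. p (s (Suc k) - s k) < (1/2) ^ k"
  obtains l where "l \<in> bounded_seqs Z" "\<And>k. p (s k - l) \<le> 2 * (1/2) ^ k"
proof -
  define close where "close n k \<longleftrightarrow> (\<forall>i<k. nrm (Z n) (s (Suc i) n - s i n) < (1/2) ^ i)" for n k
  define \<kappa> where "\<kappa> n = Max {k. k \<le> n \<and> close n k}" for n
  have fin: "finite {k. k \<le> n \<and> close n k}" for n by (rule finite_subset[of _ "{..n}"]) auto
  have "0 \<in> {k. k \<le> n \<and> close n k}" for n by (simp add: close_def)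
  then have \<kappa>: "close n (\<kappa> n)" for n using Max_in[OF fin[of n]] unfolding \<kappa>_def by blast
  define l where "l n = s (\<kappa> n) n" for n
  have sZ: "s k n \<in> vecs (Z n)" for k n by (rule bounded_seqs_mem[OF s])
  have step: "nrm (Z n) (s k n - s (k + j) n) \<le> 2 * (1/2) ^ k - 2 * (1/2) ^ (k + j)"
    if "close n (k + j)" for n k j
    using that
  proof (induction j)
    case 0
    then show ?case using nrm_0[OF Z] by simp
  next
    case (Suc j)
    then have "nrm (Z n) (s k n - s (k + j) n) \<le> 2 * (1/2) ^ k - 2 * (1/2) ^ (k + j)"
      by (simp add: close_def)
    moreover have "nrm (Z n) (s (k + j) n - s (k + Suc j) n) < (1/2) ^ (k + j)"
      using Suc.prems nrm_commute[OF Z sZ sZ, of n "k + j" "Suc (k + j)"] by (simp add: close_def)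
    moreover have "nrm (Z n) (s k n - s (k + Suc j) n)
        \<le> nrm (Z n) (s k n - s (k + j) n) + nrm (Z n) (s (k + j) n - s (k + Suc j) n)"
      by (rule nrm_triangle3[OF Z sZ sZ sZ])
    moreover have "2 * (1/2) ^ (k + Suc j) = ((1/2) ^ (k + j) :: real)" by simp
    ultimately show ?case by linarith
  qed
  have near: "nrm (Z n) (s k n - l n) \<le> 2 * (1/2) ^ k" if "k \<le> \<kappa> n" for k n
  proof -
    have "nrm (Z n) (s k n - s (k + (\<kappa> n - k)) n) \<le> 2 * (1/2) ^ k - 2 * (1/2) ^ (k + (\<kappa> n - k))"
      by (rule step) (use that \<kappa> in simp)
    also have "\<dots> \<le> 2 * (1/2) ^ k" by simp
    finally show ?thesis using that by (simp add: l_def)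
  qed
  have l: "l \<in> bounded_seqs Z"
  proof -
    obtain K where K: "\<And>n. nrm (Z n) (s 0 n) \<le> K" using s[of 0] unfolding bounded_seqs_def by blast
    have "nrm (Z n) (l n) \<le> K + 2" for n
    proof -
      have "\<bar>nrm (Z n) (s 0 n) - nrm (Z n) (l n)\<bar> \<le> nrm (Z n) (s 0 n - l n)"
        unfolding l_def by (rule nrm_diff_le[OF Z sZ sZ])
      then show ?thesis using near[of 0 n] K[of n] by simp
    qed
    then show ?thesis unfolding bounded_seqs_def l_def using sZ by blast
  qed
  have "p (s k - l) \<le> 2 * (1/2) ^ k" for k
  proof (rule tendsto_upperbound[OF lim _ G(1)])
    show "s k - l \<in> bounded_seqs Z" by (rule subspace_diff[OF subspace_seqs s l])
    have "\<forall>\<^sub>F n in G. \<forall>i\<in>{..<k}. nrm (Z n) ((s (Suc i) - s i) n) < (1/2) ^ i"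
    proof (intro eventually_ball_finite ballI finite_lessThan)
      fix i
      show "\<forall>\<^sub>F n in G. nrm (Z n) ((s (Suc i) - s i) n) < (1/2) ^ i"
        by (rule order_tendstoD(2)[OF lim[OF subspace_diff[OF subspace_seqs s s]] small])
    qed
    moreover have "\<forall>\<^sub>F n in G. k \<le> n"
      using eventually_ge_at_top[of k] G(2) by (rule filter_leD[rotated])
    ultimately show "\<forall>\<^sub>F n in G. nrm (Z n) ((s k - l) n) \<le> 2 * (1/2) ^ k"
    proof eventually_elim
      case (elim n)
      then have "close n k" by (simp add: close_def)
      then have "k \<le> \<kappa> n" unfolding \<kappa>_def using elim fin by (intro Max_ge) auto
      then show ?case using near by simp
    qed
  qed
  then show thesis using that l by blast
qed

end

lemma fast_subsequence:
  fixes q :: "'x \<Rightarrow> 'x \<Rightarrow> real"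
  assumes "\<And>e. e > 0 \<Longrightarrow> \<exists>M. \<forall>m\<ge>M. \<forall>n\<ge>M. q (x m) (x n) < e"
  obtains h :: "nat \<Rightarrow> nat" where "\<And>k m. h k \<le> m \<Longrightarrow> q (x m) (x (h k)) < (1/2) ^ k" "\<And>k. h k \<le> h (Suc k)"
proof -
  have "\<exists>h. \<forall>k. (\<forall>m n. h k \<le> m \<longrightarrow> h k \<le> n \<longrightarrow> q (x m) (x n) < (1/2) ^ k) \<and> h k \<le> h (Suc k)"
  proof (rule dependent_nat_choice)
    show "\<exists>M. \<forall>m n. M \<le> m \<longrightarrow> M \<le> n \<longrightarrow> q (x m) (x n) < (1/2) ^ 0" using assms[of "(1/2)^0"] by auto
    fix M k
    obtain L where L: "\<forall>m\<ge>L. \<forall>n\<ge>L. q (x m) (x n) < (1/2) ^ Suc k" using assms[of "(1/2) ^ Suc k"] by auto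
    show "\<exists>N. (\<forall>m n. N \<le> m \<longrightarrow> N \<le> n \<longrightarrow> q (x m) (x n) < (1/2) ^ Suc k) \<and> M \<le> N"
      using L by (intro exI[of _ "max L M"]) auto
  qed
  then show thesis using that by blast
qed

text \<open>
  What is needed to map \<open>A\<close> isometrically into an ultraproduct of the \<open>Z n\<close>.
\<close>

definition asymptotically_embeds :: "('a::real_vector) nspace \<Rightarrow> (nat \<Rightarrow> ('v::real_vector) nspace) \<Rightarrow> bool" where
  "asymptotically_embeds A Z \<longleftrightarrow>
     (\<exists>u. (\<forall>n. linear_on (vecs A) (u n) \<and> u n ` vecs A \<subseteq> vecs (Z n)) \<and>
          (\<forall>a\<in>vecs A. (\<lambda>n. nrm (Z n) (u n a)) \<longlonglongrightarrow> nrm A a))"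

text \<open>
  The vectors of \<open>X\<close> are chosen bounded sequences, one in each class modulo the kernel of the limit
  seminorm. Hence evaluation at \<open>n\<close> is a linear map from \<open>X\<close> to \<open>Z n\<close>, and these evaluations are the
  almost isometric embeddings on finite-dimensional subspaces.
\<close>

lemma ultraproduct:
  fixes Z :: "nat \<Rightarrow> ('v::real_vector) nspace"
  assumes Z: "\<And>n. normed_space (Z n)"
  obtains X :: "(nat \<Rightarrow> 'v) nspace" where "banach_space X"
    "\<forall>A\<in>subspaces_of X. \<forall>r>1. \<exists>n. embeds r (rep_minkowski A) (Z n)"
    "\<forall>A. asymptotically_embeds (rep_minkowski A) Z \<longrightarrow> A \<in> subspaces_of X"
proof -
  have "\<exists>K. \<forall>n. \<bar>if s \<in> bounded_seqs Z then nrm (Z n) (s n) else 0\<bar> \<le> K" for s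
  proof (cases "s \<in> bounded_seqs Z")
    case True
    then obtain K where "\<And>n. nrm (Z n) (s n) \<le> K" unfolding bounded_seqs_def by blast
    then show ?thesis using True normed_spaceD(2)[OF Z bounded_seqs_mem[OF True]] by (intro exI[of _ K]) auto
  qed auto
  then obtain G p where cluster: "G \<le> sequentially" "G \<noteq> bot"
    "\<And>s. ((\<lambda>n. if s \<in> bounded_seqs Z then nrm (Z n) (s n) else 0) \<longlongrightarrow> p s) G"
    using pointwise_cluster_filter[of sequentially "\<lambda>n s. if s \<in> bounded_seqs Z then nrm (Z n) (s n) else 0"]
      sequentially_bot by metis
  interpret norm_limit Z G p
  proof
    show "((\<lambda>n. nrm (Z n) (s n)) \<longlongrightarrow> p s) G" if "s \<in> bounded_seqs Z" for s using cluster(3)[of s] that by simp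
  qed (use Z cluster in auto)
  let ?E = "bounded_seqs Z"
  have "kernel \<subseteq> ?E" unfolding kernel_def by blast
  then obtain \<pi> where \<pi>: "linear \<pi>" "\<And>x. x \<in> ?E \<Longrightarrow> \<pi> x \<in> ?E" "\<And>x. x \<in> ?E \<Longrightarrow> x - \<pi> x \<in> kernel"
    "\<And>x. x \<in> kernel \<Longrightarrow> \<pi> x = 0"
    using complement_projection[OF subspace_seqs subspace_kernel] by metis
  define X where "X = \<lparr>vecs = \<pi> ` ?E, nrm = p\<rparr>"
  have Xv: "vecs X = \<pi> ` ?E" and Xn: "nrm X = p" by (simp_all add: X_def)
  have XE: "x \<in> ?E" if "x \<in> vecs X" for x using that \<pi>(2) unfolding Xv by blast
  have p\<pi>: "p (\<pi> x) = p x" if "x \<in> ?E" for x using p_cong[OF that \<pi>(2)[OF that] \<pi>(3)[OF that]] by simp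
  have \<pi>X: "\<pi> x = x" if x: "x \<in> vecs X" for x
  proof -
    obtain y where y: "y \<in> ?E" "x = \<pi> y" using x unfolding Xv by blast
    have "\<pi> (y - \<pi> y) = 0" by (rule \<pi>(4)[OF \<pi>(3)[OF y(1)]])
    then show ?thesis using y linear_diff[OF \<pi>(1)] by simp
  qed
  have sX: "subspace (vecs X)" unfolding Xv by (rule linear_subspace_image[OF \<pi>(1) subspace_seqs])
  have nX: "normed_space X"
    unfolding normed_space_def Xn
  proof (intro conjI ballI allI sX)
    fix x assume x: "x \<in> vecs X"
    show "0 \<le> p x" by (rule p_nonneg[OF XE[OF x]])
    show "p x = 0 \<longleftrightarrow> x = 0"
    proof
      assume "p x = 0"
      then have "x \<in> kernel" using XE[OF x] unfolding kernel_def by blast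
      then show "x = 0" using \<pi>(4) \<pi>X[OF x] by simp
    next
      assume "x = 0"
      then show "p x = 0" using subspace_0[OF subspace_kernel] unfolding kernel_def by blast
    qed
    show "p (c *\<^sub>R x) = \<bar>c\<bar> * p x" for c by (rule p_scale[OF XE[OF x]])
    show "p (x + y) \<le> p x + p y" if "y \<in> vecs X" for y by (rule p_triangle[OF XE[OF x] XE[OF that]])
  qed
  have "banach_space X"
    unfolding banach_space_def
  proof (intro conjI nX allI impI, elim conjE)
    fix x :: "nat \<Rightarrow> nat \<Rightarrow> 'v"
    assume x: "\<forall>n. x n \<in> vecs X" and C: "\<forall>e>0. \<exists>M. \<forall>m\<ge>M. \<forall>n\<ge>M. nrm X (x m - x n) < e"
    then have xX: "x n \<in> vecs X" for n by blast
    obtain h where h: "\<And>k m. h k \<le> m \<Longrightarrow> nrm X (x m - x (h k)) < (1/2) ^ k" "\<And>k. h k \<le> h (Suc k)"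
      using fast_subsequence[of "\<lambda>a b. nrm X (a - b)" x] C by auto
    obtain l where l: "l \<in> ?E" "\<And>k. p (x (h k) - l) \<le> 2 * (1/2) ^ k"
      using p_complete[of "\<lambda>k. x (h k)"] h XE[OF xX] unfolding Xn by metis
    have lX: "\<pi> l \<in> vecs X" using l(1) unfolding Xv by blast
    have 1: "nrm X (x (h k) - \<pi> l) \<le> 2 * (1/2) ^ k" for k
    proof -
      have "\<pi> (x (h k) - l) = x (h k) - \<pi> l" using \<pi>X[OF xX] by (simp add: linear_diff[OF \<pi>(1)])
      then show ?thesis
        using p\<pi>[OF subspace_diff[OF subspace_seqs XE[OF xX] l(1)]] l(2) unfolding Xn by metis
    qed
    have 2: "nrm X (x m - \<pi> l) \<le> 3 * (1/2) ^ k" if "h k \<le> m" for m k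
      using nrm_triangle3[OF nX xX xX lX, of m "h k"] h(1)[OF that] 1[of k] by linarith
    have "(\<lambda>m. nrm X (x m - \<pi> l)) \<longlonglongrightarrow> 0"
    proof (rule LIMSEQ_I)
      fix e :: real assume e: "e > 0"
      obtain k where k: "(1/2 :: real) ^ k < e / 3" using real_arch_pow_inv[of "e/3" "1/2"] e by auto
      have "norm (nrm X (x m - \<pi> l) - 0) < e" if "m \<ge> h k" for m
        using 2[OF that] k normed_spaceD(2)[OF nX subspace_diff[OF sX xX lX], of m] by simp
      then show "\<exists>no. \<forall>m\<ge>no. norm (nrm X (x m - \<pi> l) - 0) < e" by blast
    qed
    then show "\<exists>l\<in>vecs X. (\<lambda>n. nrm X (x n - l)) \<longlonglongrightarrow> 0" using lX by blast
  qed
  moreover have "\<exists>n. embeds r (rep_minkowski A) (Z n)" if A: "A \<in> subspaces_of X" and r: "r > 1" for A r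
  proof -
    let ?A = "rep_minkowski A"
    obtain \<sigma> where \<sigma>: "linear_on (vecs ?A) \<sigma>" "\<sigma> ` vecs ?A \<subseteq> vecs X"
      "\<And>a. a \<in> vecs ?A \<Longrightarrow> p (\<sigma> a) = nrm ?A a"
      using A unfolding subspaces_of_iff[OF nX] embeds_def Xn by force
    obtain d b where b: "fin_basis d b (vecs ?A)" using fin_basis_exists[OF rep_minkowski_fd(2)] .
    have \<sigma>E: "\<sigma> a \<in> ?E" if "a \<in> vecs ?A" for a using \<sigma>(2) that XE by blast
    have "\<forall>\<^sub>F n in G. embeds r ?A (Z n)"
    proof (rule eventually_embeds[OF _ b Z, where T = "\<lambda>n a. \<sigma> a n"])
      show "linear_on (vecs ?A) (\<lambda>a. \<sigma> a n)" for n using \<sigma>(1) unfolding linear_on_def by simp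
      show "(\<lambda>a. \<sigma> a n) ` vecs ?A \<subseteq> vecs (Z n)" for n using bounded_seqs_mem[OF \<sigma>E] by blast
      fix ks :: "int list"
      have a: "int_comb b ks \<in> vecs ?A"
        unfolding int_comb_def
        by (intro subspace_sum subspace_scale rep_minkowski_subspace fin_basis_mem(2)[OF b])
      show "((\<lambda>n. nrm (Z n) (\<sigma> (int_comb b ks) n)) \<longlongrightarrow> nrm ?A (int_comb b ks)) G"
        using lim[OF \<sigma>E[OF a]] \<sigma>(3)[OF a] by simp
    qed (use r in auto)
    then show ?thesis using eventually_happens'[OF G(1)] by blast
  qed
  moreover have "A \<in> subspaces_of X"
    if A: "asymptotically_embeds (rep_minkowski A) Z" for A
  proof -
    let ?A = "rep_minkowski A"
    obtain u where u: "\<And>n. linear_on (vecs ?A) (u n)" "\<And>n. u n ` vecs ?A \<subseteq> vecs (Z n)"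
      "\<And>a. a \<in> vecs ?A \<Longrightarrow> (\<lambda>n. nrm (Z n) (u n a)) \<longlonglongrightarrow> nrm ?A a"
      using A unfolding asymptotically_embeds_def by blast
    define \<sigma> where "\<sigma> a n = u n a" for a n
    have \<sigma>E: "\<sigma> a \<in> ?E" if a: "a \<in> vecs ?A" for a
    proof -
      have "Bseq (\<lambda>n. nrm (Z n) (u n a))" by (rule convergent_imp_Bseq[OF convergentI[OF u(3)[OF a]]])
      then obtain K where "\<And>n. norm (nrm (Z n) (u n a)) \<le> K" unfolding Bseq_def by blast
      then have K: "nrm (Z n) (u n a) \<le> K" for n by (simp add: abs_le_iff)
      have "u n a \<in> vecs (Z n)" for n using u(2)[of n] a by (simp add: image_subset_iff)
      with K show ?thesis unfolding bounded_seqs_def \<sigma>_def by auto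
    qed
    have p\<sigma>: "p (\<sigma> a) = nrm ?A a" if a: "a \<in> vecs ?A" for a
      by (rule tendsto_unique[OF G(1) lim[OF \<sigma>E[OF a]]])
        (use tendsto_mono[OF G(2) u(3)[OF a]] in \<open>simp add: \<sigma>_def\<close>)
    have "linear_on (vecs ?A) (\<lambda>a. \<pi> (\<sigma> a))"
    proof -
      have "\<sigma> (x + y) = \<sigma> x + \<sigma> y" if "x \<in> vecs ?A" "y \<in> vecs ?A" for x y
        using u(1) that unfolding linear_on_def \<sigma>_def by (simp add: fun_eq_iff)
      moreover have "\<sigma> (c *\<^sub>R x) = c *\<^sub>R \<sigma> x" if "x \<in> vecs ?A" for x c
        using u(1) that unfolding linear_on_def \<sigma>_def by (simp add: fun_eq_iff)
      ultimately show ?thesis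
        unfolding linear_on_def by (simp add: linear_add[OF \<pi>(1)] linear_scale[OF \<pi>(1)])
    qed
    then show ?thesis
      unfolding subspaces_of_iff[OF nX] embeds_def Xn Xv
      using \<sigma>E p\<pi> p\<sigma> by (intro exI[of _ "\<lambda>a. \<pi> (\<sigma> a)"]) auto
  qed
  ultimately show thesis using that[of X] by blast
qed

section \<open>Finite-dimensional subspaces of a normed space\<close>

lemma isometric_imp_embeds:
  assumes "isometric X Y"
  shows "embeds 1 X Y"
  using assms unfolding isometric_def embeds_def bij_betw_def by force

lemma subspaces_of_trans:
  assumes X: "normed_space X" and "B \<in> msubspaces_of A" "A \<in> subspaces_of X"
  shows "B \<in> subspaces_of X"
  using embeds_trans[of 1 "rep_minkowski B" "rep_minkowski A" 1 X] assms
  by (simp add: subspaces_of_iff)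

lemma subspaces_of_directed:
  assumes X: "normed_space X" and A: "A \<in> subspaces_of X" and B: "B \<in> subspaces_of X"
  obtains C where "C \<in> subspaces_of X" "A \<in> msubspaces_of C" "B \<in> msubspaces_of C"
proof -
  obtain A' where A': "fd_subspace A' X" "A' \<noteq> {0}" "isometric (rep_minkowski A) (restr X A')"
    using A unfolding subspaces_of_def by blast
  obtain B' where B': "fd_subspace B' X" "isometric (rep_minkowski B) (restr X B')"
    using B unfolding subspaces_of_def by blast
  obtain S T where S: "finite S" "A' = span S" and T: "finite T" "B' = span T"
    using A'(1) B'(1) unfolding fd_subspace_def fin_dim_def by blast
  define V where "V = span (S \<union> T)"
  have AV: "A' \<subseteq> V" and BV: "B' \<subseteq> V" unfolding V_def S T by (auto intro: span_mono[THEN subsetD])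
  have "S \<subseteq> vecs X" "T \<subseteq> vecs X"
    using A'(1) B'(1) S T span_superset unfolding fd_subspace_def by blast+
  then have VX: "V \<subseteq> vecs X" unfolding V_def by (intro span_minimal normed_spaceD(1)[OF X]) auto
  have fd: "fin_dim V" unfolding fin_dim_def V_def by (intro exI[of _ "S \<union> T"]) (simp add: S T)
  have "V \<noteq> {0}" using A'(2) AV subspace_0[of A'] S by auto
  then obtain C where C: "isometric (rep_minkowski C) (restr X V)"
    using fin_dim_copy[of "restr X V"] normed_space_restr[OF X fin_dim_subspace[OF fd] VX] fd by auto
  have VC: "embeds 1 (restr X V) (rep_minkowski C)"
    by (rule isometric_imp_embeds[OF isometric_sym[OF rep_minkowski_subspace C]])
  have inc: "embeds 1 (restr X W) (restr X W')" if "W \<subseteq> W'" for W W'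
    unfolding embeds_def linear_on_def using that by (intro exI[of _ "\<lambda>x. x"]) auto
  have sub: "M \<in> msubspaces_of C" if "isometric (rep_minkowski M) (restr X W)" "W \<subseteq> V" for M W
    using embeds_trans[OF embeds_trans[OF isometric_imp_embeds[OF that(1)] inc[OF that(2)]] VC]
    by (simp add: subspaces_of_iff)
  have "embeds 1 (restr X V) X"
    unfolding embeds_def linear_on_def using VX by (intro exI[of _ "\<lambda>x. x"]) auto
  then have "C \<in> subspaces_of X"
    using embeds_trans[OF isometric_imp_embeds[OF C], of 1 X] by (simp add: subspaces_of_iff[OF X])
  then show thesis using sub[OF A'(3) AV] sub[OF B'(2) BV] by (rule that)
qed

text \<open>
  \<open>U\<close> is an ultrapower of \<open>X\<close>: embeddings into \<open>X\<close> with distortion \<open>1 + 1/(n + 1)\<close> combine to an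
  isometric embedding into \<open>U\<close>.
\<close>

lemma closure_subspaces_of_attained:
  fixes X :: "('v::real_vector) nspace"
  assumes X: "normed_space X"
  obtains U :: "(nat \<Rightarrow> 'v) nspace" where "normed_space U" "subspaces_of U = closure (subspaces_of X)"
proof -
  obtain U :: "(nat \<Rightarrow> 'v) nspace" where U: "banach_space U"
    "\<forall>A\<in>subspaces_of U. \<forall>r>1. \<exists>n::nat. embeds r (rep_minkowski A) X"
    "\<forall>A. asymptotically_embeds (rep_minkowski A) (\<lambda>_. X) \<longrightarrow> A \<in> subspaces_of U"
    by (rule ultraproduct[of "\<lambda>_. X", OF X])
  have "subspaces_of U = closure (subspaces_of X)"
  proof
    show "subspaces_of U \<subseteq> closure (subspaces_of X)"
      unfolding closure_subspaces_of[OF X] using U(2) by blast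
    show "closure (subspaces_of X) \<subseteq> subspaces_of U"
    proof
      fix A assume "A \<in> closure (subspaces_of X)"
      then have e: "embeds r (rep_minkowski A) X" if "r > 1" for r
        using that unfolding closure_subspaces_of[OF X] by blast
      let ?r = "\<lambda>n. 1 + inverse (real (Suc n))"
      have "embeds (?r n) (rep_minkowski A) X" for n by (rule e) simp
      then obtain u where u: "\<And>n. linear_on (vecs (rep_minkowski A)) (u n)"
        "\<And>n. u n ` vecs (rep_minkowski A) \<subseteq> vecs X"
        "\<And>n a. a \<in> vecs (rep_minkowski A) \<Longrightarrow> nrm (rep_minkowski A) a \<le> nrm X (u n a)
            \<and> nrm X (u n a) \<le> ?r n * nrm (rep_minkowski A) a"
        unfolding embeds_def by metis
      have "(\<lambda>n. nrm X (u n a)) \<longlonglongrightarrow> nrm (rep_minkowski A) a" if a: "a \<in> vecs (rep_minkowski A)" for a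
      proof -
        have "(\<lambda>n. ?r n * nrm (rep_minkowski A) a) \<longlonglongrightarrow> (1 + 0) * nrm (rep_minkowski A) a"
          by (intro tendsto_intros LIMSEQ_inverse_real_of_nat)
        then have lim: "(\<lambda>n. ?r n * nrm (rep_minkowski A) a) \<longlonglongrightarrow> nrm (rep_minkowski A) a" by simp
        show "(\<lambda>n. nrm X (u n a)) \<longlonglongrightarrow> nrm (rep_minkowski A) a"
          by (rule tendsto_sandwich[OF always_eventually always_eventually tendsto_const lim])
            (use u(3)[OF a] in auto)
      qed
      then have "asymptotically_embeds (rep_minkowski A) (\<lambda>_. X)"
        unfolding asymptotically_embeds_def using u(1,2) by blast
      then show "A \<in> subspaces_of U" using U(3) by blast
    qed
  qed
  with U(1) show thesis by (intro that) (auto simp: banach_space_def)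
qed

section \<open>Separability\<close>

lemma fin_basis_map:
  fixes b' :: "nat \<Rightarrow> 'w::real_vector"
  assumes b: "fin_basis d b V"
  obtains T where "linear_on V T" "\<And>c. T (\<Sum>i<d. c i *\<^sub>R b i) = (\<Sum>i<d. c i *\<^sub>R b' i)"
proof -
  have "\<exists>c. x = (\<Sum>i<d. c i *\<^sub>R b i)" if "x \<in> V" for x
    using b that unfolding fin_basis_def by blast
  then obtain \<kappa> where \<kappa>: "\<And>x. x \<in> V \<Longrightarrow> x = (\<Sum>i<d. \<kappa> x i *\<^sub>R b i)" by metis
  define T where "T x = (\<Sum>i<d. \<kappa> x i *\<^sub>R b' i)" for x
  have T: "T (\<Sum>i<d. c i *\<^sub>R b i) = (\<Sum>i<d. c i *\<^sub>R b' i)" for c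
  proof -
    let ?x = "\<Sum>i<d. c i *\<^sub>R b i"
    have "(\<Sum>i<d. (\<kappa> ?x i - c i) *\<^sub>R b i) = 0"
      using \<kappa>[OF fin_basis_mem(1)[OF b], of c] by (simp add: scaleR_diff_left sum_subtractf)
    then have "\<kappa> ?x i - c i = 0" if "i < d" for i by (rule fin_basis_zeroD[OF b _ that])
    then show ?thesis unfolding T_def by (intro sum.cong) auto
  qed
  have "linear_on V T"
    unfolding linear_on_def
  proof (intro conjI ballI allI)
    fix x assume x: "x \<in> V"
    show "T (x + y) = T x + T y" if y: "y \<in> V" for y
    proof -
      have "x + y = (\<Sum>i<d. (\<kappa> x i + \<kappa> y i) *\<^sub>R b i)"
        using \<kappa>[OF x] \<kappa>[OF y] by (simp add: scaleR_add_left sum.distrib)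
      then have "T (x + y) = (\<Sum>i<d. (\<kappa> x i + \<kappa> y i) *\<^sub>R b' i)" using T by metis
      then show ?thesis unfolding T_def by (simp add: scaleR_add_left sum.distrib)
    qed
    show "T (c *\<^sub>R x) = c *\<^sub>R T x" for c
    proof -
      have "c *\<^sub>R x = (\<Sum>i<d. (c * \<kappa> x i) *\<^sub>R b i)"
        using arg_cong[OF \<kappa>[OF x], of "\<lambda>z. c *\<^sub>R z"] by (simp add: scaleR_sum_right)
      then have "T (c *\<^sub>R x) = (\<Sum>i<d. (c * \<kappa> x i) *\<^sub>R b' i)" using T by metis
      then show ?thesis unfolding T_def by (simp add: scaleR_sum_right)
    qed
  qed
  with T show thesis by (intro that)
qed

text \<open>
  With a basis of every space fixed, a space becomes a point of the second-countable space of
  functions on integer lists, namely its norm on integer combinations. Convergence of such points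
  means that the linear maps matching the bases are eventually almost isometric.
\<close>

lemma countable_approximating_subset:
  fixes N :: "minkowski set"
  obtains D where "countable D" "D \<subseteq> N"
    "\<And>A r. A \<in> N \<Longrightarrow> r > 1 \<Longrightarrow> \<exists>M\<in>D. embeds r (rep_minkowski A) (rep_minkowski M)"
proof -
  have "\<exists>d b. fin_basis d b (vecs (rep_minkowski A))" for A
  proof -
    obtain d b where "fin_basis d b (vecs (rep_minkowski A))" by (rule fin_basis_exists[OF rep_minkowski_fd(2)])
    then show ?thesis by blast
  qed
  then obtain d b where b: "\<And>A. fin_basis (d A) (b A) (vecs (rep_minkowski A))" by metis
  define f :: "minkowski \<Rightarrow> int list \<Rightarrow> real"
    where "f A ks = nrm (rep_minkowski A) (int_comb (b A) ks)" for A ks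
  obtain T where T: "countable T" "T \<subseteq> f ` N" "f ` N \<subseteq> closure T" by (rule separable)
  have "\<exists>D. countable D \<and> D \<subseteq> N \<and> T = f ` D"
    by (rule iffD1[OF countable_subset_image conjI[OF T(1,2)]])
  then obtain D where D: "countable D" "D \<subseteq> N" "T = f ` D" by (elim exE conjE)
  have "\<exists>M\<in>D. embeds r (rep_minkowski A) (rep_minkowski M)" if A: "A \<in> N" and r: "r > 1" for A r
  proof -
    have "f A \<in> closure (f ` D)" using A T(3) D(3) by blast
    then obtain y where y: "\<And>n. y n \<in> f ` D" "y \<longlonglongrightarrow> f A" unfolding closure_sequential by blast
    have "\<exists>m. m \<in> D \<and> y n = f m" for n using y(1)[of n] by (rule imageE) blast
    then obtain M where M: "\<And>n. M n \<in> D" "\<And>n. y n = f (M n)" by metis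
    have conv: "(\<lambda>n. f (M n) ks) \<longlonglongrightarrow> f A ks" for ks
      using continuous_on_tendsto_compose[OF continuous_on_product_coordinates[of ks] y(2)] M(2) by simp
    have "\<exists>S. linear_on (vecs (rep_minkowski A)) S \<and>
        (\<forall>c. S (\<Sum>i<d A. c i *\<^sub>R b A i) = (\<Sum>i<d A. c i *\<^sub>R b (M n) i))" for n
      using fin_basis_map[OF b[of A], of "b (M n)"] by metis
    then obtain S where S: "\<And>n. linear_on (vecs (rep_minkowski A)) (S n)"
      "\<And>n c. S n (\<Sum>i<d A. c i *\<^sub>R b A i) = (\<Sum>i<d A. c i *\<^sub>R b (M n) i)" by metis
    have "\<forall>\<^sub>F n in sequentially. embeds r (rep_minkowski A) (rep_minkowski (M n))"
    proof (rule eventually_embeds[OF _ b[of A], where T = S])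
      show "S n ` vecs (rep_minkowski A) \<subseteq> vecs (rep_minkowski (M n))" for n
      proof
        fix z assume "z \<in> S n ` vecs (rep_minkowski A)"
        then obtain x where x: "x \<in> vecs (rep_minkowski A)" "z = S n x" by blast
        then obtain c where "x = (\<Sum>i<d A. c i *\<^sub>R b A i)" using b[of A] unfolding fin_basis_def by auto
        then have "z = (\<Sum>i<d A. c i *\<^sub>R b (M n) i)" using x(2) S(2) by simp
        also have "\<dots> \<in> vecs (rep_minkowski (M n))"
          by (intro subspace_sum subspace_scale rep_minkowski_subspace fin_basis_mem(2)[OF b])
        finally show "z \<in> vecs (rep_minkowski (M n))" .
      qed
      fix ks :: "int list" assume ks: "length ks = d A"
      have "S n (int_comb (b A) ks) = int_comb (b (M n)) ks" for n
        unfolding int_comb_def ks by (rule S(2))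
      then show "(\<lambda>n. nrm (rep_minkowski (M n)) (S n (int_comb (b A) ks)))
          \<longlonglongrightarrow> nrm (rep_minkowski A) (int_comb (b A) ks)"
        using conv[of ks] by (simp add: f_def)
    qed (use S(1) r in auto)
    then show ?thesis using eventually_happens'[OF sequentially_bot] M(1) by blast
  qed
  with D show thesis by (intro that)
qed

section \<open>Copies in a prescribed ambient space\<close>

lemma banach_space_linear_copy:
  fixes X :: "('a::real_vector) nspace" and g :: "'a \<Rightarrow> 'b::real_vector"
  assumes X: "banach_space X" and g: "linear g" "inj g"
  obtains Y :: "'b nspace" where "banach_space Y" "embeds 1 X Y" "embeds 1 Y X"
proof -
  define Y where "Y = \<lparr>vecs = g ` vecs X, nrm = \<lambda>y. nrm X (inv g y)\<rparr>"
  have Yv: "vecs Y = g ` vecs X" and Yn: "nrm Y (g x) = nrm X x" for x using g(2) by (simp_all add: Y_def)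
  have nX: "normed_space X" using X by (simp add: banach_space_def)
  note sX = normed_spaceD(1)[OF nX]
  have g0: "g x = 0 \<longleftrightarrow> x = 0" for x using g linear_0 by (metis injD)
  have nY: "normed_space Y"
    unfolding normed_space_def Yv ball_simps
  proof (intro conjI ballI allI)
    show "subspace (g ` vecs X)" by (rule linear_subspace_image[OF g(1) sX])
    fix x assume x: "x \<in> vecs X"
    show "0 \<le> nrm Y (g x)" "nrm Y (g x) = 0 \<longleftrightarrow> g x = 0"
      using normed_spaceD(2,3)[OF nX x] by (simp_all add: Yn g0)
    show "nrm Y (c *\<^sub>R g x) = \<bar>c\<bar> * nrm Y (g x)" for c
      using normed_spaceD(4)[OF nX x] by (simp add: linear_scale[OF g(1), symmetric] Yn)
    show "nrm Y (g x + g y) \<le> nrm Y (g x) + nrm Y (g y)" if "y \<in> vecs X" for y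
      using normed_spaceD(5)[OF nX x that] by (simp add: linear_add[OF g(1), symmetric] Yn)
  qed
  have "banach_space Y"
    unfolding banach_space_def
  proof (intro conjI nY allI impI, elim conjE)
    fix s :: "nat \<Rightarrow> 'b"
    assume s: "\<forall>n. s n \<in> vecs Y" and C: "\<forall>e>0. \<exists>M. \<forall>m\<ge>M. \<forall>n\<ge>M. nrm Y (s m - s n) < e"
    have "\<forall>n. \<exists>x. x \<in> vecs X \<and> s n = g x" using s unfolding Yv by blast
    then obtain x where x: "\<And>n. x n \<in> vecs X" "\<And>n. s n = g (x n)" by metis
    have eq: "nrm Y (g a - g b) = nrm X (a - b)" for a b by (simp add: linear_diff[OF g(1), symmetric] Yn)
    have "(\<forall>n. x n \<in> vecs X) \<and> (\<forall>e>0. \<exists>M. \<forall>m\<ge>M. \<forall>n\<ge>M. nrm X (x m - x n) < e)"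
      using C x unfolding x(2) eq by blast
    then obtain l where l: "l \<in> vecs X" "(\<lambda>n. nrm X (x n - l)) \<longlonglongrightarrow> 0"
      using X[unfolded banach_space_def, THEN conjunct2, THEN spec[of _ x], THEN mp] by blast
    then have "(\<lambda>n. nrm Y (s n - g l)) \<longlonglongrightarrow> 0" unfolding x(2) eq by simp
    with l(1) show "\<exists>l\<in>vecs Y. (\<lambda>n. nrm Y (s n - l)) \<longlonglongrightarrow> 0" unfolding Yv by blast
  qed
  moreover have "embeds 1 X Y"
    unfolding embeds_def linear_on_def
    by (rule exI[of _ g]) (simp add: Yv Yn linear_add[OF g(1)] linear_scale[OF g(1)])
  moreover have "embeds 1 Y X"
    unfolding embeds_def
  proof (intro exI conjI)
    show "linear_on (vecs Y) (inv g)"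
      unfolding linear_on_def Yv ball_simps
      using g(2) by (simp add: linear_add[OF g(1), symmetric] linear_scale[OF g(1), symmetric])
  qed (use g(2) in \<open>auto simp: Yv Yn\<close>)
  ultimately show thesis by (rule that)
qed

text \<open>
  A sequence of finitely supported real sequences is coded by a set of natural numbers, each real
  being replaced by such a set.
\<close>

lemma poly_mapping_seqs_inj_real:
  obtains \<iota> :: "(nat \<Rightarrow> (nat \<Rightarrow>\<^sub>0 real)) \<Rightarrow> real" where "inj \<iota>"
proof -
  obtain \<beta> :: "nat set \<Rightarrow> real" where \<beta>: "bij \<beta>"
    using nat_sets_eqpoll_reals unfolding eqpoll_def by blast
  define \<rho> where "\<rho> = inv \<beta>"
  have \<rho>: "inj \<rho>" unfolding \<rho>_def using \<beta> by (simp add: bij_imp_bij_inv bij_is_inj)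
  define \<gamma> :: "(nat \<Rightarrow> (nat \<Rightarrow>\<^sub>0 real)) \<Rightarrow> nat set"
    where "\<gamma> f = {prod_encode (n, prod_encode (m, k)) |n m k. k \<in> \<rho> (Poly_Mapping.lookup (f n) m)}" for f
  have mem: "prod_encode (n, prod_encode (m, k)) \<in> \<gamma> f \<longleftrightarrow> k \<in> \<rho> (Poly_Mapping.lookup (f n) m)" for f n m k
    unfolding \<gamma>_def by auto
  have "inj \<gamma>"
  proof (rule injI)
    fix f g assume "\<gamma> f = \<gamma> g"
    then have "\<rho> (Poly_Mapping.lookup (f n) m) = \<rho> (Poly_Mapping.lookup (g n) m)" for n m using mem by blast
    then have "Poly_Mapping.lookup (f n) m = Poly_Mapping.lookup (g n) m" for n m using \<rho> by (metis injD)
    then show "f = g" by (intro ext poly_mapping_eqI) 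
  qed
  then have "inj (\<beta> \<circ> \<gamma>)" using \<beta> by (intro inj_compose) (auto simp: bij_is_inj)
  then show thesis by (rule that)
qed

lemma linear_injection_exists:
  fixes e :: "real \<Rightarrow> 'v::real_vector" and \<iota> :: "'a::real_vector \<Rightarrow> real"
  assumes e: "inj e" "independent (range e)" and \<iota>: "inj \<iota>"
  obtains g :: "'a \<Rightarrow> 'v" where "linear g" "inj g"
proof -
  obtain B where B: "B \<subseteq> (UNIV :: 'a set)" "independent B" "UNIV \<subseteq> span B"
    by (rule maximal_independent_subset)
  obtain g where g: "linear g" "\<forall>x\<in>B. g x = e (\<iota> x)"
    using linear_independent_extend[OF B(2), of "\<lambda>x. e (\<iota> x)"] by blast
  have "g ` B \<subseteq> range e" using g(2) by auto
  then have ind: "independent (g ` B)" using e(2) independent_mono by blast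
  have "inj_on g B" using g(2) e(1) \<iota> by (intro inj_onI) (metis injD)
  then have "inj_on g (span B)" by (rule linear_inj_on_span_independent_image[OF g(1) ind])
  then have "inj g" using B(3) by (rule inj_on_subset)
  with g(1) show thesis by (rule that)
qed

section \<open>Realization of a set of spaces\<close>

text \<open>
  The zero space realizes the empty set, because only nonzero subspaces count.
\<close>

lemma trivial_space:
  "banach_space \<lparr>vecs = {0::'v::real_vector}, nrm = \<lambda>_. 0\<rparr>"
  "subspaces_of \<lparr>vecs = {0::'v::real_vector}, nrm = \<lambda>_. 0\<rparr> = {}"
proof -
  show "banach_space \<lparr>vecs = {0::'v}, nrm = \<lambda>_. 0\<rparr>"
    unfolding banach_space_def normed_space_def by auto
  have "B = {0}" if "fin_dim B" "B \<subseteq> {0}" for B :: "'v set"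
    using that subspace_0[OF fin_dim_subspace[OF that(1)]] by blast
  then show "subspaces_of \<lparr>vecs = {0::'v}, nrm = \<lambda>_. 0\<rparr> = {}"
    unfolding subspaces_of_def fd_subspace_def by auto
qed

text \<open>
  Condition \<open>(A\<^sub>0)\<close> absorbs a countable approximating family one by one into a chain \<open>c\<close>, and \<open>X\<close> is an
  ultraproduct of that chain.
\<close>

lemma banach_space_realizing:
  fixes N :: "minkowski set"
  assumes H: "\<And>A B. A \<in> N \<Longrightarrow> B \<in> msubspaces_of A \<Longrightarrow> B \<in> N"
    and A0: "\<And>A B. A \<in> N \<Longrightarrow> B \<in> N \<Longrightarrow> \<exists>C\<in>N. A \<in> msubspaces_of C \<and> B \<in> msubspaces_of C"
    and C: "closed N" and ne: "N \<noteq> {}"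
  obtains X :: "(nat \<Rightarrow> (nat \<Rightarrow>\<^sub>0 real)) nspace" where "banach_space X" "closure (subspaces_of X) = N"
proof -
  obtain D where D: "countable D" "D \<subseteq> N"
    "\<And>A r. A \<in> N \<Longrightarrow> r > 1 \<Longrightarrow> \<exists>M\<in>D. embeds r (rep_minkowski A) (rep_minkowski M)"
    using countable_approximating_subset[of N] by blast
  have "D \<noteq> {}" using ne D(3)[of _ 2] by fastforce
  define a where "a = from_nat_into D"
  have aN: "a n \<in> N" for n using from_nat_into[OF \<open>D \<noteq> {}\<close>] D(2) unfolding a_def by blast
  have "\<exists>c. \<forall>n. (c n \<in> N \<and> a n \<in> msubspaces_of (c n)) \<and> c n \<in> msubspaces_of (c (Suc n))"
  proof (rule dependent_nat_choice)
    show "\<exists>x. x \<in> N \<and> a 0 \<in> msubspaces_of x" using A0[OF aN aN] by blast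
    fix x n assume "x \<in> N \<and> a n \<in> msubspaces_of x"
    then show "\<exists>y. (y \<in> N \<and> a (Suc n) \<in> msubspaces_of y) \<and> x \<in> msubspaces_of y"
      using A0[of x "a (Suc n)"] aN by blast
  qed
  then obtain c where c: "\<And>n. c n \<in> N" "\<And>n. a n \<in> msubspaces_of (c n)"
    "\<And>n. c n \<in> msubspaces_of (c (Suc n))" by blast
  have ac: "embeds 1 (rep_minkowski (a m)) (rep_minkowski (c n))" if "m \<le> n" for m n
    using that
  proof (induction n rule: dec_induct)
    case base
    then show ?case using c(2) by (simp add: subspaces_of_iff)
  next
    case (step n)
    then show ?case using embeds_trans[OF step(3), of 1] c(3)[of n] by (simp add: subspaces_of_iff)
  qed
  obtain X :: "(nat \<Rightarrow> (nat \<Rightarrow>\<^sub>0 real)) nspace" where X: "banach_space X"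
    "\<forall>A\<in>subspaces_of X. \<forall>r>1. \<exists>n. embeds r (rep_minkowski A) (rep_minkowski (c n))"
    "\<forall>A. asymptotically_embeds (rep_minkowski A) (\<lambda>n. rep_minkowski (c n)) \<longrightarrow> A \<in> subspaces_of X"
    by (rule ultraproduct[of "\<lambda>n. rep_minkowski (c n)", OF rep_minkowski_normed])
  have nX: "normed_space X" using X(1) by (simp add: banach_space_def)
  have aX: "a m \<in> subspaces_of X" for m
  proof -
    let ?A = "rep_minkowski (a m)"
    have "\<exists>u. linear_on (vecs ?A) u \<and> u ` vecs ?A \<subseteq> vecs (rep_minkowski (c n)) \<and>
        (m \<le> n \<longrightarrow> (\<forall>x\<in>vecs ?A. nrm (rep_minkowski (c n)) (u x) = nrm ?A x))" for n
    proof (cases "m \<le> n")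
      case True
      then show ?thesis using ac[OF True] unfolding embeds_def by (force intro: antisym)
    next
      case False
      then show ?thesis
        using subspace_0[OF rep_minkowski_subspace] by (intro exI[of _ "\<lambda>_. 0"]) (auto simp: linear_on_def)
    qed
    then obtain u where u: "\<And>n. linear_on (vecs ?A) (u n)"
      "\<And>n. u n ` vecs ?A \<subseteq> vecs (rep_minkowski (c n))"
      "\<And>n x. m \<le> n \<Longrightarrow> x \<in> vecs ?A \<Longrightarrow> nrm (rep_minkowski (c n)) (u n x) = nrm ?A x" by metis
    have "(\<lambda>n. nrm (rep_minkowski (c n)) (u n x)) \<longlonglongrightarrow> nrm ?A x" if "x \<in> vecs ?A" for x
    proof (rule tendsto_eventually)
      show "\<forall>\<^sub>F n in sequentially. nrm (rep_minkowski (c n)) (u n x) = nrm ?A x"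
        using eventually_ge_at_top[of m] by eventually_elim (use u(3) that in blast)
    qed
    then have "asymptotically_embeds ?A (\<lambda>n. rep_minkowski (c n))"
      unfolding asymptotically_embeds_def using u(1,2) by blast
    then show ?thesis using X(3) by blast
  qed
  have "closure (subspaces_of X) = N"
  proof
    show "closure (subspaces_of X) \<subseteq> N"
    proof (rule closure_minimal[OF _ C], rule subsetI)
      fix A assume A: "A \<in> subspaces_of X"
      \<comment> \<open>the image of A in some c n belongs to N by heredity\<close>
      have "\<exists>M\<in>N. mdist A M \<le> ereal r" if r: "r > 1" for r
      proof -
        obtain n where "embeds r (rep_minkowski A) (rep_minkowski (c n))" using X(2) A r by blast
        then show ?thesis using subspace_near_of_embeds[OF rep_minkowski_normed] H[OF c(1)] by metis
      qed
      then have "A \<in> closure N" by (rule closure_minkowskiI)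
      then show "A \<in> N" using C by simp
    qed
    show "N \<subseteq> closure (subspaces_of X)"
      unfolding closure_subspaces_of[OF nX]
    proof (intro subsetI CollectI allI impI)
      \<comment> \<open>approximate by a member of the countable family, which X contains isometrically\<close>
      fix A and r :: real assume A: "A \<in> N" and r: "1 < r"
      obtain M where M: "M \<in> D" "embeds r (rep_minkowski A) (rep_minkowski M)" using D(3)[OF A r] by blast
      obtain m where "M = a m" using from_nat_into_surj[OF D(1) M(1)] unfolding a_def by metis
      then have "embeds 1 (rep_minkowski M) X" using aX subspaces_of_iff[OF nX] by blast
      then show "embeds r (rep_minkowski A) X" using embeds_trans[OF M(2), of 1 X] by simp
    qed
  qed
  with X(1) show thesis by (rule that)
qed

(* A Banach space is a subspace of the ambient vector space 'v with its own complete norm. The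
   assumptions say that the algebraic dimension of 'v is at least the continuum, the least algebraic
   dimension of an infinite-dimensional Banach space; every Banach space is linearly isomorphic
   to a subspace of some such 'v, and the equivalence holds for each of them. *)
theorem theorem16:
  fixes e :: "real \<Rightarrow> 'v::real_vector"
    and N :: "minkowski set"
  assumes "inj e" and "independent (range e)"
  shows "(\<exists>X :: 'v nspace. banach_space X \<and> minkowski_of (fin_class X) = N) \<longleftrightarrow>
     (\<forall>A\<in>N. \<forall>B\<in>msubspaces_of A. B \<in> N) \<and>
     (\<forall>A\<in>N. \<forall>B\<in>N. \<exists>C\<in>N. A \<in> msubspaces_of C \<and> B \<in> msubspaces_of C) \<and>
     closed N"
proof
  assume "\<exists>X :: 'v nspace. banach_space X \<and> minkowski_of (fin_class X) = N"
  then obtain X :: "'v nspace" where X: "banach_space X" "N = closure (subspaces_of X)"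
    using minkowski_of_fin_class by metis
  then obtain U :: "(nat \<Rightarrow> 'v) nspace" where U: "normed_space U" "subspaces_of U = N"
    using closure_subspaces_of_attained[of X] by (metis banach_space_def)
  have "\<exists>C\<in>N. A \<in> msubspaces_of C \<and> B \<in> msubspaces_of C" if "A \<in> N" "B \<in> N" for A B
    using subspaces_of_directed[OF U(1), of A B] that unfolding U(2) by metis
  moreover have "B \<in> N" if "A \<in> N" "B \<in> msubspaces_of A" for A B
    using subspaces_of_trans[OF U(1) that(2)] that(1) unfolding U(2) by blast
  ultimately show "(\<forall>A\<in>N. \<forall>B\<in>msubspaces_of A. B \<in> N) \<and>
     (\<forall>A\<in>N. \<forall>B\<in>N. \<exists>C\<in>N. A \<in> msubspaces_of C \<and> B \<in> msubspaces_of C) \<and>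
     closed N" using X(2) by auto
next
  assume N: "(\<forall>A\<in>N. \<forall>B\<in>msubspaces_of A. B \<in> N) \<and>
     (\<forall>A\<in>N. \<forall>B\<in>N. \<exists>C\<in>N. A \<in> msubspaces_of C \<and> B \<in> msubspaces_of C) \<and>
     closed N"
  have "\<exists>Y :: 'v nspace. banach_space Y \<and> closure (subspaces_of Y) = N"
  proof (cases "N = {}")
    case True
    then show ?thesis using trivial_space by (metis closure_empty)
  next
    case False
    then obtain X :: "(nat \<Rightarrow> (nat \<Rightarrow>\<^sub>0 real)) nspace"
      where X: "banach_space X" "closure (subspaces_of X) = N"
      using banach_space_realizing[of N] N by metis
    obtain \<iota> :: "(nat \<Rightarrow> (nat \<Rightarrow>\<^sub>0 real)) \<Rightarrow> real" where "inj \<iota>" by (rule poly_mapping_seqs_inj_real)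
    then obtain g :: "(nat \<Rightarrow> (nat \<Rightarrow>\<^sub>0 real)) \<Rightarrow> 'v" where g: "linear g" "inj g"
      by (rule linear_injection_exists[OF assms])
    obtain Y :: "'v nspace" where Y: "banach_space Y" "embeds 1 X Y" "embeds 1 Y X"
      by (rule banach_space_linear_copy[OF X(1) g])
    have nX: "normed_space X" and nY: "normed_space Y" using X(1) Y(1) by (auto simp: banach_space_def)
    have "subspaces_of Y = subspaces_of X"
      using embeds_trans[OF _ Y(2), of 1] embeds_trans[OF _ Y(3), of 1]
      by (auto simp: subspaces_of_iff[OF nX] subspaces_of_iff[OF nY])
    with X(2) Y(1) show ?thesis by auto
  qed
  then show "\<exists>X :: 'v nspace. banach_space X \<and> minkowski_of (fin_class X) = N"
    using minkowski_of_fin_class by blast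
qed

end
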